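(* Let $1\le p\le2$ and $p^{-1}+p'^{-1}=1$. Given $0<\alpha<\pi/2$, a positive integer $\nu$, and a real $c>0$, let $\gamma$ be a boxed curve, $\gamma\in\mathfrak{B}_\alpha(\nu,c)$. The operator $\mathcal{L}_\gamma$ (the Laplace transform restricted to $\gamma$) acts continuously from $L^p(\mathbb{R}_+)$ to $L^{p'}(\gamma)$. Its norm is bounded by a constant that depends on $\alpha$, $c$, $\nu$, and $p$. In particular, for the class $\mathfrak{B}_*(c)=\mathfrak{B}_{\pi/4}(1,c)$ the following uniform estimate holds: $$\sup_{\gamma\in\mathfrak{B}_*(c)}\|\mathcal{L}_\gamma\|_{L^p(\mathbb{R}_+)\to L^{p'}(\gamma)}<\big(1344\,\pi\,(c^{-1}+2)\big)^{1/p'}.$$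
   Context: $\mathbb{R}_+=(0,\infty)$. A compound curve is a finite or countable family $\gamma=\{\gamma_n\}$ of rectifiable curves; its arclength measure $\mu_\gamma$ is the sum of the arclength measures of the $\gamma_n$, and $L^{p'}(\gamma)$ is taken with respect to $\mu_\gamma$. $\mathcal{L}_\gamma f$ is the restriction to $\gamma$ of the Laplace transform $\mathcal{L}f(z)=\int_0^\infty f(t)e^{-zt}\,dt$. Convex curves: a closed curve is convex if it is the boundary of a convex set; a non-closed curve on a compact parameter interval is convex if the closed curve obtained by joining its endpoints by a straight segment is convex; a curve on a non-compact parameter interval is convex if its restrictions to an exhausting sequence of compact intervals are convex. Boxed curves: let $\{a_n\}_{n\ge1}$ be a strictly increasing real sequence and $b_n>0$. Let $B_n$ be the closed rectangle with sides parallel to the axes, with lower left corner $a_n$ and upper right corner $a_{n+1}+ib_n$. A boxed curve with parameters $\{a_n\},\{b_n\}$ is a compound curve $\gamma=\{\gamma_n\}_{n\ge1}$ where each $\gamma_n$ is a convex curve contained in $B_n$. $\mathfrak{B}(\nu,c)$ is the class of boxed curves whose parameters satisfy $b_1\le b_2\le b_3\le\dots$ and $$\frac{a_{n+\nu}-a_n}{\nu}\ge c\,b_n\quad\text{for all }n\ge1.$$ $\mathfrak{B}_\alpha(\nu,c)$ is the subclass of those curves in $\mathfrak{B}(\nu,c)$ that lie in the sector $0\le\arg z\le\alpha$.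
   Formalization: The final uniform estimate is proved with strict "<" for 1 < p ≤ 2 and with "≤" for p = 1, since at p = 1 the right-hand side equals 1 and every operator norm from L^1 to L^∞(γ) is exactly 1, so the strict inequality fails there. *)

theory Defs
  imports "HOL-Analysis.Analysis" "HOL-Probability.Essential_Supremum"
begin

section \<open>Lebesgue spaces\<close>

text \<open>
  Exponents are extended, so that the conjugate exponent of 1 is \<open>\<infinity>\<close>.  Functions
  are not identified modulo null sets; \<open>Lp_norm\<close> is the seminorm that becomes the
  norm on the quotient.
\<close>

definition Lp_norm :: "ennreal \<Rightarrow> 'a measure \<Rightarrow> ('a \<Rightarrow> complex) \<Rightarrow> ennreal" where
  "Lp_norm p M f =
     (if p = \<infinity> then esssup M (\<lambda>x. ennreal (norm (f x)))
      else let J = \<integral>\<^sup>+x. ennreal (norm (f x) powr enn2real p) \<partial>M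
           in if J = \<infinity> then \<infinity> else ennreal (enn2real J powr (1 / enn2real p)))"

definition Lp_space :: "ennreal \<Rightarrow> 'a measure \<Rightarrow> ('a \<Rightarrow> complex) set" where
  "Lp_space p M = {f \<in> borel_measurable M. Lp_norm p M f < \<infinity>}"

definition acts_continuously ::
  "ennreal \<Rightarrow> 'a measure \<Rightarrow> ennreal \<Rightarrow> 'b measure \<Rightarrow> (('a \<Rightarrow> complex) \<Rightarrow> 'b \<Rightarrow> complex) \<Rightarrow> bool" where
  "acts_continuously p M q N T \<longleftrightarrow>
     (\<forall>f\<in>Lp_space p M. T f \<in> Lp_space q N) \<and>
     (\<forall>f\<in>Lp_space p M. \<forall>\<epsilon>>0. \<exists>\<delta>>0. \<forall>g\<in>Lp_space p M.
        Lp_norm p M (\<lambda>x. g x - f x) < \<delta> \<longrightarrow> Lp_norm q N (\<lambda>y. T g y - T f y) < \<epsilon>)"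

definition Lp_op_norm ::
  "ennreal \<Rightarrow> 'a measure \<Rightarrow> ennreal \<Rightarrow> 'b measure \<Rightarrow> (('a \<Rightarrow> complex) \<Rightarrow> 'b \<Rightarrow> complex) \<Rightarrow> ennreal" where
  "Lp_op_norm p M q N T = (SUP f\<in>{f \<in> Lp_space p M. Lp_norm p M f \<le> 1}. Lp_norm q N (T f))"

section \<open>The Laplace transform\<close>

abbreviation lborel_pos :: "real measure" where
  "lborel_pos \<equiv> restrict_space lborel {0<..}"

definition laplace_integrable :: "(real \<Rightarrow> complex) \<Rightarrow> complex \<Rightarrow> bool" where
  "laplace_integrable f z \<longleftrightarrow> integrable lborel_pos (\<lambda>t. f t * exp (- z * of_real t))"

definition laplace :: "(real \<Rightarrow> complex) \<Rightarrow> complex \<Rightarrow> complex" where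
  "laplace f z = (LINT t|lborel_pos. f t * exp (- z * of_real t))"

section \<open>Curves and arclength\<close>

text \<open>A curve is a parameter interval, compact or not, together with a parametrization.\<close>

type_synonym curve = "real set \<times> (real \<Rightarrow> complex)"

definition curve_trace :: "curve \<Rightarrow> complex set" where
  "curve_trace \<gamma> = snd \<gamma> ` fst \<gamma>"

definition is_curve :: "curve \<Rightarrow> bool" where
  "is_curve \<gamma> \<longleftrightarrow>
     is_interval (fst \<gamma>) \<and> interior (fst \<gamma>) \<noteq> {} \<and> continuous_on (fst \<gamma>) (snd \<gamma>)"

definition curve_length :: "(real \<Rightarrow> complex) \<Rightarrow> real set \<Rightarrow> ennreal" where
  "curve_length g S =
     (SUP ts\<in>{ts. sorted ts \<and> set ts \<subseteq> S}.
        \<Sum>i<length ts - 1. ennreal (dist (g (ts ! i)) (g (ts ! Suc i))))"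

definition rectifiable :: "curve \<Rightarrow> bool" where
  "rectifiable \<gamma> \<longleftrightarrow> is_curve \<gamma> \<and> curve_length (snd \<gamma>) (fst \<gamma>) < \<infinity>"

text \<open>
  Arclength is the Lebesgue--Stieltjes measure of the length function on the parameter
  interval, transported to the plane by the parametrization (so a piece of the trace that
  is traversed twice counts twice).  It is meaningful for rectifiable curves only: for
  these the length function is finite, monotone and continuous on the whole real line.
\<close>

definition arclength_measure :: "curve \<Rightarrow> complex measure" where
  "arclength_measure \<gamma> =
     distr (restrict_space
              (interval_measure (\<lambda>t. enn2real (curve_length (snd \<gamma>) (fst \<gamma> \<inter> {..t}))))
              (fst \<gamma>))
       borel (snd \<gamma>)"

text \<open>
  Compound curves are indexed by the integers \<open>n \<ge> 1\<close>; the value of such a family at 0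
  is irrelevant.
\<close>

definition compound_arclength_measure :: "(nat \<Rightarrow> curve) \<Rightarrow> complex measure" where
  "compound_arclength_measure \<gamma> =
     measure_of UNIV (sets borel) (\<lambda>A. \<Sum>n. emeasure (arclength_measure (\<gamma> (Suc n))) A)"

section \<open>Convex curves\<close>

text \<open>
  A closed path is the boundary of the convex set \<open>K\<close> if it runs through the frontier of
  \<open>K\<close> exactly once.  If \<open>K\<close> has empty interior then it is, up to closure, a line segment,
  and its boundary curve is the segment traversed back and forth; in this case each point
  is visited at most twice.  This degenerate case is needed for straight segments to
  be convex curves.
\<close>

definition convex_closed_path :: "(real \<Rightarrow> complex) \<Rightarrow> bool" where
  "convex_closed_path q \<longleftrightarrow>
     path q \<and> pathfinish q = pathstart q \<and>
     (\<exists>K. convex K \<and> path_image q = frontier K \<and>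
        (if interior K \<noteq> {} then simple_path q
         else \<forall>z. finite {t\<in>{0..<1}. q t = z} \<and> card {t\<in>{0..<1}. q t = z} \<le> 2))"

text \<open>
  The restriction of \<open>g\<close> to \<open>{s..t}\<close>, reparametrized over the unit interval, is
  \<open>g \<circ> linepath s t\<close>.
\<close>

definition convex_on_segment :: "(real \<Rightarrow> complex) \<Rightarrow> real \<Rightarrow> real \<Rightarrow> bool" where
  "convex_on_segment g s t \<longleftrightarrow>
     (if g s = g t then convex_closed_path (g \<circ> linepath s t)
      else convex_closed_path ((g \<circ> linepath s t) +++ linepath (g t) (g s)))"

definition convex_curve :: "curve \<Rightarrow> bool" where
  "convex_curve \<gamma> \<longleftrightarrow> is_curve \<gamma> \<and>
     (if compact (fst \<gamma>)
      then \<exists>s t. s < t \<and> fst \<gamma> = {s..t} \<and> convex_on_segment (snd \<gamma>) s t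
      else \<exists>s t :: nat \<Rightarrow> real.
             (\<forall>k. s k < t k \<and> {s k..t k} \<subseteq> {s (Suc k)..t (Suc k)}) \<and>
             (\<Union>k. {s k..t k}) = fst \<gamma> \<and>
             (\<forall>k. convex_on_segment (snd \<gamma>) (s k) (t k)))"

section \<open>Boxed curves\<close>

definition boxed_curve :: "(nat \<Rightarrow> real) \<Rightarrow> (nat \<Rightarrow> real) \<Rightarrow> (nat \<Rightarrow> curve) \<Rightarrow> bool" where
  "boxed_curve a b \<gamma> \<longleftrightarrow>
     (\<forall>n\<ge>1. a n < a (Suc n)) \<and> (\<forall>n\<ge>1. 0 < b n) \<and>
     (\<forall>n\<ge>1. rectifiable (\<gamma> n) \<and> convex_curve (\<gamma> n) \<and>
        curve_trace (\<gamma> n) \<subseteq> cbox (complex_of_real (a n)) (Complex (a (Suc n)) (b n)))"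

definition boxed_class :: "nat \<Rightarrow> real \<Rightarrow> (nat \<Rightarrow> curve) set" where
  "boxed_class \<nu> c = {\<gamma>. \<exists>a b. boxed_curve a b \<gamma> \<and>
     (\<forall>n\<ge>1. b n \<le> b (Suc n)) \<and>
     (\<forall>n\<ge>1. (a (n + \<nu>) - a n) / real \<nu> \<ge> c * b n)}"

text \<open>The sector contains its vertex, since \<open>Arg 0 = 0\<close>.\<close>

definition boxed_class_sector :: "real \<Rightarrow> nat \<Rightarrow> real \<Rightarrow> (nat \<Rightarrow> curve) set" where
  "boxed_class_sector \<alpha> \<nu> c =
     {\<gamma> \<in> boxed_class \<nu> c. \<forall>n\<ge>1. curve_trace (\<gamma> n) \<subseteq> {z. 0 \<le> Arg z \<and> Arg z \<le> \<alpha>}}"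

end

theory Submission
  imports Defs "HOL-Real_Asymp.Real_Asymp"
begin

text \<open>
  The sector is used only through \<open>Re z \<ge> 0\<close> and a bound for heights, because
  \<open>\<bar>laplace f z\<bar>\<close> is at most the transform of \<open>\<bar>f\<bar>\<close> at \<open>Re z\<close>.  By convexity almost every
  vertical or horizontal line meets a curve at most twice, so the length of any part of it is at
  most the perimeter of a box containing that part.  Adding up, the part of the compound curve
  with \<open>Re z < X\<close> has length at most \<open>D X\<close>.  Hence \<open>exp (- a Re z)\<close> has integral at
  most \<open>D / a\<close> along the curve, and Hilbert's inequality gives the case \<open>p = 2\<close> with constant
  \<open>pi D\<close>.  The case \<open>p = 1\<close> is trivial.  In between no interpolation theorem is needed: the
  kernel is positive, so Hoelder's inequality applied to
  \<open>\<bar>f\<bar> = (\<bar>f\<bar> powr p) powr (1 - \<theta>) * (\<bar>f\<bar> powr (p / 2)) powr \<theta>\<close> with \<open>\<theta> = 2 / p'\<close> reduces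
  to the two endpoints.
\<close>

section \<open>Transforms of nonnegative functions\<close>

text \<open>Squaring the transform and integrating over the curve first leaves the kernel D / (s +
  t), so the growth of arclength in Re z is all that the analysis needs of the geometry. The
  obstacle lies in that growth: the part of a convex curve in a half-plane need not be a parameter
  interval, while arclength is a Stieltjes measure in the parameter and length is a supremum over
  polygons. Hence two upper estimates for pieces with gaps: the measure of a relatively open piece
  is at most its polygonal length, by superadditivity over dyadic cells, and polygonal length is
  controlled by counting preimages of levels. Countably many levels are discarded, because a
  coordinate is constant along a flat horizontal or vertical side. The constant is D = 2 + 2/c + 2
  (\<nu> + 1) tan \<alpha>: twice the total width, twice the heights that telescope, and \<nu> + 1
  boxes whose height only the sector controls. For \<alpha> = pi/4 and \<nu> = 1 this yields pi (6 +
  2/c), so the stated 1344 pi (1/c + 2) is reached with a wide margin.\<close>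

lemma sigma_finite_lborel_pos: "sigma_finite_measure lborel_pos"
  by (intro sigma_finite_measure_restrict_space lborel.sigma_finite_measure_axioms) auto

lemma nn_integral_lborel_pos:
  "(\<integral>\<^sup>+t. f t \<partial>lborel_pos) = (\<integral>\<^sup>+t. f t * indicator {0<..} t \<partial>lborel)"
  by (rule nn_integral_restrict_space) auto

section \<open>Exponential integrals against a measure with linear growth in Re z\<close>

lemma nn_integral_exp_tail:
  assumes "0 < (a::real)"
  shows "(\<integral>\<^sup>+x. ennreal (a * exp (- a * x)) * indicator {y<..} x \<partial>lborel) = ennreal (exp (- a * y))"
proof -
  have "((\<lambda>x. - exp (- a * x)) \<longlongrightarrow> 0) at_top"
    using assms by real_asymp
  hence "(\<integral>\<^sup>+x. ennreal (a * exp (- a * x)) * indicator {y..} x \<partial>lborel) = ennreal (0 - - exp (- a * y))"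
    using assms by (intro nn_integral_FTC_atLeast) (auto intro!: derivative_eq_intros)
  moreover have "(\<integral>\<^sup>+x. ennreal (a * exp (- a * x)) * indicator {y<..} x \<partial>lborel)
      = (\<integral>\<^sup>+x. ennreal (a * exp (- a * x)) * indicator {y..} x \<partial>lborel)"
    by (intro nn_integral_cong_AE eventually_mono[OF AE_lborel_singleton[of y]])
       (auto simp: indicator_def)
  ultimately show ?thesis by simp
qed

lemma nn_integral_exp_moment:
  assumes "0 < (a::real)"
  shows "(\<integral>\<^sup>+x. ennreal (a * x * exp (- a * x)) * indicator {0..} x \<partial>lborel) = ennreal (1 / a)"
proof -
  have "((\<lambda>x. - (x + 1 / a) * exp (- a * x)) \<longlongrightarrow> 0) at_top"
    using assms by real_asymp
  hence "(\<integral>\<^sup>+x. ennreal (a * x * exp (- a * x)) * indicator {0..} x \<partial>lborel)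
      = ennreal (0 - - (0 + 1 / a) * exp (- a * 0))"
    using assms by (intro nn_integral_FTC_atLeast) (auto intro!: derivative_eq_intros simp: field_simps)
  thus ?thesis by simp
qed

text \<open>Tonelli's theorem needs sigma-finiteness, and the half-planes
  \<open>Re z < n + 1\<close> exhaust the plane.\<close>

lemma sigma_finite_half_planes:
  fixes M :: "complex measure"
  assumes "sets M = sets borel"
    and "\<And>X. 0 < X \<Longrightarrow> emeasure M {z. Re z < X} \<le> ennreal (D * X)"
  shows "sigma_finite_measure M"
proof
  have "space M = UNIV" using sets_eq_imp_space_eq[OF assms(1)] by simp
  moreover have "(\<Union>n. {z. Re z < real (Suc n)}) = UNIV"
  proof (intro set_eqI iffI)
    fix z
    obtain n where "Re z < real n" using reals_Archimedean2 by blast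
    hence "Re z < real (Suc n)" by simp
    thus "z \<in> (\<Union>n. {z. Re z < real (Suc n)})" by blast
  qed simp
  moreover have "{z. Re z < real (Suc n)} \<in> sets M" for n
    unfolding assms(1) by (intro borel_open open_halfspace_Re_lt)
  moreover have "emeasure M {z. Re z < real (Suc n)} \<noteq> \<infinity>" for n
    using assms(2)[of "real (Suc n)"] by (auto simp: top_unique)
  ultimately show "\<exists>A. countable A \<and> A \<subseteq> sets M \<and> \<Union> A = space M \<and> (\<forall>a\<in>A. emeasure M a \<noteq> \<infinity>)"
    by (intro exI[of _ "range (\<lambda>n. {z. Re z < real (Suc n)})"]) auto
qed

text \<open>Layer-cake formula: \<open>exp (- a * Re z)\<close> is the mass of x > Re z under the
  density \<open>a * exp (- a * x)\<close>. Tonelli turns the integral into one of that density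
  against \<open>emeasure M {z. Re z < x}\<close>, which is at most D x for x > 0 and vanishes for x
  \<le> 0; the first moment of the density is 1 / a.\<close>

lemma nn_integral_exp_Re:
  fixes M :: "complex measure"
  assumes sets: "sets M = sets borel"
    and pos: "AE z in M. 0 \<le> Re z"
    and bound: "\<And>X. 0 < X \<Longrightarrow> emeasure M {z. Re z < X} \<le> ennreal (D * X)"
    and "0 < a"
  shows "(\<integral>\<^sup>+z. ennreal (exp (- a * Re z)) \<partial>M) \<le> ennreal (D / a)"
proof -
  interpret M: sigma_finite_measure M using sets bound by (rule sigma_finite_half_planes)
  interpret pair_sigma_finite lborel M ..
  note [measurable_cong] = sets
  have [measurable]: "Re \<in> borel_measurable M"
    by (subst measurable_cong_sets[OF sets refl]) (intro borel_measurable_continuous_onI continuous_intros)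
  have space: "space M = UNIV" using sets_eq_imp_space_eq[OF sets] by simp
  have neg: "emeasure M {z. Re z < x} = 0" if "x \<le> 0" for x
  proof -
    have "AE z in M. z \<notin> {z. Re z < x}" using pos by eventually_elim (use that in auto)
    moreover have "{z. Re z < x} \<in> sets M"
      unfolding sets by (intro borel_open open_halfspace_Re_lt)
    ultimately show ?thesis by (simp add: AE_iff_measurable[OF _ refl] space)
  qed
  have "(\<integral>\<^sup>+z. ennreal (exp (- a * Re z)) \<partial>M)
      = (\<integral>\<^sup>+z. (\<integral>\<^sup>+x. ennreal (a * exp (- a * x)) * indicator {Re z<..} x \<partial>lborel) \<partial>M)"
    by (simp add: nn_integral_exp_tail[OF \<open>0 < a\<close>, simplified])
  also have "\<dots> = (\<integral>\<^sup>+z. (\<integral>\<^sup>+x. ennreal (a * exp (- a * x)) * (if Re z < x then 1 else 0) \<partial>lborel) \<partial>M)"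
    by (intro nn_integral_cong) (auto simp: indicator_def)
  also have "\<dots> = (\<integral>\<^sup>+x. (\<integral>\<^sup>+z. ennreal (a * exp (- a * x)) * (if Re z < x then 1 else 0) \<partial>M) \<partial>lborel)"
    by (intro Fubini') measurable
  also have "\<dots> = (\<integral>\<^sup>+x. ennreal (a * exp (- a * x)) * emeasure M {z. Re z < x} \<partial>lborel)"
  proof (intro nn_integral_cong)
    fix x :: real
    have "{z. Re z < x} \<in> sets M"
      unfolding sets by (intro borel_open open_halfspace_Re_lt)
    hence "(\<integral>\<^sup>+z. indicator {z. Re z < x} z \<partial>M) = emeasure M {z. Re z < x}"
      by (rule nn_integral_indicator)
    moreover have "(\<lambda>z. indicator {z. Re z < x} z :: ennreal) = (\<lambda>z. if Re z < x then 1 else 0)"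
      by (auto simp: indicator_def)
    ultimately show "(\<integral>\<^sup>+z. ennreal (a * exp (- a * x)) * (if Re z < x then 1 else 0) \<partial>M)
        = ennreal (a * exp (- a * x)) * emeasure M {z. Re z < x}"
      by (simp add: nn_integral_cmult)
  qed
  also have "\<dots> \<le> (\<integral>\<^sup>+x. ennreal D * (ennreal (a * x * exp (- a * x)) * indicator {0..} x) \<partial>lborel)"
  proof (intro nn_integral_mono)
    fix x :: real
    show "ennreal (a * exp (- a * x)) * emeasure M {z. Re z < x}
        \<le> ennreal D * (ennreal (a * x * exp (- a * x)) * indicator {0..} x)"
    proof (cases "0 < x")
      case True
      have "ennreal (a * exp (- a * x)) * emeasure M {z. Re z < x}
          \<le> ennreal (a * exp (- a * x)) * ennreal (D * x)"
        by (intro mult_left_mono bound True) auto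
      \<comment> \<open>A negative D is harmless, because \<open>ennreal\<close> truncates both
        sides to 0.\<close>
      also have "\<dots> \<le> ennreal D * (ennreal (a * x * exp (- a * x)) * indicator {0..} x)"
        using True \<open>0 < a\<close>
        by (cases "0 \<le> D") (simp_all add: ennreal_mult'[symmetric] ennreal_neg mult_nonpos_nonneg mult.left_commute)
      finally show ?thesis .
    qed (simp add: neg)
  qed
  also have "\<dots> = ennreal D * ennreal (1 / a)"
    by (simp add: nn_integral_cmult nn_integral_exp_moment[OF \<open>0 < a\<close>, simplified])
  also have "\<dots> = ennreal (D / a)"
    using \<open>0 < a\<close> by (simp add: ennreal_mult''[symmetric])
  finally show ?thesis .
qed

section \<open>Hilbert's inequality\<close>

text \<open>The substitution t = s u^2 turns the integrand into 2 / (1 + u^2), whence the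
  antiderivative 2 arctan (sqrt (t / s)). The weight sqrt (s / t) makes the value independent of
  s.\<close>

lemma nn_integral_schur_kernel:
  assumes "0 < (s::real)"
  shows "(\<integral>\<^sup>+t. ennreal (sqrt (s / t) / (s + t)) \<partial>lborel_pos) = ennreal pi"
proof -
  let ?f = "\<lambda>t. sqrt (s / t) / (s + t)"
  have deriv: "DERIV (\<lambda>t. 2 * arctan (sqrt (t / s))) t :> ?f t" if "0 < t" for t
  proof -
    have "DERIV (\<lambda>t. 2 * arctan (sqrt (t / s))) t :>
        2 * (inverse (1 + (sqrt (t / s))\<^sup>2) * (inverse (sqrt (t / s)) / 2 * (1 / s)))"
      using divide_pos_pos[OF that assms] by (auto intro!: derivative_eq_intros)
    also have "2 * (inverse (1 + (sqrt (t / s))\<^sup>2) * (inverse (sqrt (t / s)) / 2 * (1 / s))) = ?f t"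
    proof -
      \<comment> \<open>Replacing s and t by squares removes every root, so that the identity
        becomes rational.\<close>
      define u v where "u = sqrt s" and "v = sqrt t"
      have "0 < u" "0 < v" and st: "s = u\<^sup>2" "t = v\<^sup>2" using that assms by (auto simp: u_def v_def)
      moreover have "u\<^sup>2 + v\<^sup>2 \<noteq> 0" using \<open>0 < u\<close> by simp
      ultimately show ?thesis
        unfolding st by (simp add: real_sqrt_divide divide_simps)
    qed
    finally show ?thesis .
  qed
  have lim0: "(((\<lambda>t. 2 * arctan (sqrt (t / s))) \<circ> real_of_ereal) \<longlongrightarrow> 0) (at_right (ereal 0))"
  proof -
    have "((\<lambda>t. 2 * arctan (sqrt (t / s))) \<longlongrightarrow> 0) (at_right 0)"
      using assms by real_asymp
    thus ?thesis by (simp only: ereal_tendsto_simps)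
  qed
  have liminf: "(((\<lambda>t. 2 * arctan (sqrt (t / s))) \<circ> real_of_ereal) \<longlongrightarrow> pi) (at_left \<infinity>)"
  proof -
    have "((\<lambda>t. 2 * arctan (sqrt (t / s))) \<longlongrightarrow> pi) at_top"
      using assms by real_asymp
    thus ?thesis by (simp only: ereal_tendsto_simps)
  qed
  have cont: "isCont ?f t" if "0 < t" for t
    using that assms by (intro continuous_intros) auto
  note ftc = interval_integral_FTC_nonneg[of "ereal 0" \<infinity> "\<lambda>t. 2 * arctan (sqrt (t / s))" ?f 0 pi, OF _ _ _ _ lim0 liminf]
  have int: "set_integrable lborel {0<..} ?f"
    using ftc(1) deriv cont assms by (simp add: einterval_eq(3))
  have val: "(LBINT t=ereal 0..\<infinity>. ?f t) = pi"
    using ftc(2) deriv cont assms by simp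
  have "(\<integral>\<^sup>+t. ennreal (?f t) \<partial>lborel_pos) = (\<integral>\<^sup>+t. ennreal (indicator {0<..} t *\<^sub>R ?f t) \<partial>lborel)"
    unfolding nn_integral_lborel_pos by (intro nn_integral_cong) (auto simp: indicator_def)
  also have "\<dots> = ennreal (LBINT t:{0<..}. ?f t)"
    unfolding set_lebesgue_integral_def using int assms
    by (intro nn_integral_eq_integral) (auto simp: set_integrable_def indicator_def)
  also have "(LBINT t:{0<..}. ?f t) = pi"
    using val by (simp add: interval_integral_to_infinity_eq)
  finally show ?thesis .
qed

text \<open>Schur test: the inequality of arithmetic and geometric means with ratio r = sqrt (s / t)
  splits \<open>g s * g t\<close> into two terms that are mirror images under exchange of s and t.
  Integrating out the variable without g by \<open>nn_integral_schur_kernel\<close> gives pi / 2 for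
  each.\<close>

lemma hilbert_inequality:
  fixes g :: "real \<Rightarrow> real"
  assumes [measurable]: "g \<in> borel_measurable lborel_pos" and "\<And>t. 0 \<le> g t"
  shows "(\<integral>\<^sup>+s. \<integral>\<^sup>+t. ennreal (g s * g t / (s + t)) \<partial>lborel_pos \<partial>lborel_pos)
      \<le> ennreal pi * (\<integral>\<^sup>+t. ennreal ((g t)\<^sup>2) \<partial>lborel_pos)"
proof -
  interpret N: sigma_finite_measure lborel_pos by (rule sigma_finite_lborel_pos)
  interpret pair_sigma_finite lborel_pos lborel_pos ..
  let ?k = "\<lambda>s t. (g s)\<^sup>2 / 2 * (sqrt (s / t) / (s + t))"
  have id[measurable]: "(\<lambda>t. t) \<in> borel_measurable lborel_pos"
    by (simp add: measurable_restrict_space1)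
  have [measurable]: "fst \<in> borel_measurable (lborel_pos \<Otimes>\<^sub>M lborel_pos)" "snd \<in> borel_measurable (lborel_pos \<Otimes>\<^sub>M lborel_pos)"
    by (rule measurable_compose[OF measurable_fst id] measurable_compose[OF measurable_snd id])+
  have pt: "g s * g t / (s + t) \<le> ?k s t + ?k t s" if "0 < s" "0 < t" for s t
  proof -
    define r where "r = sqrt (s / t)"
    have r: "0 < r" "sqrt (t / s) = 1 / r"
      using that by (auto simp: r_def real_sqrt_divide)
    have "0 \<le> (g s * r - g t)\<^sup>2" by simp
    hence "g s * g t \<le> ((g s)\<^sup>2 * r + (g t)\<^sup>2 / r) / 2"
      using r(1) by (simp add: field_simps power2_eq_square)
    hence "g s * g t / (s + t) \<le> ((g s)\<^sup>2 * r + (g t)\<^sup>2 / r) / 2 / (s + t)"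
      using that by (intro divide_right_mono) auto
    also have "\<dots> = ?k s t + ?k t s"
      unfolding r r_def[symmetric] using that by (simp add: add_divide_distrib ac_simps)
    finally show ?thesis .
  qed
  have half: "(\<integral>\<^sup>+s. \<integral>\<^sup>+t. ennreal (?k s t) \<partial>lborel_pos \<partial>lborel_pos)
      = ennreal (pi / 2) * (\<integral>\<^sup>+t. ennreal ((g t)\<^sup>2) \<partial>lborel_pos)"
  proof -
    have "(\<integral>\<^sup>+t. ennreal (?k s t) \<partial>lborel_pos) = ennreal (pi / 2) * ennreal ((g s)\<^sup>2)" if "0 < s" for s
    proof -
      have "(\<integral>\<^sup>+t. ennreal (?k s t) \<partial>lborel_pos)
          = (\<integral>\<^sup>+t. ennreal ((g s)\<^sup>2 / 2) * ennreal (sqrt (s / t) / (s + t)) \<partial>lborel_pos)"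
        by (intro nn_integral_cong) (simp add: ennreal_mult'[symmetric])
      also have "\<dots> = ennreal ((g s)\<^sup>2 / 2) * ennreal pi"
        by (subst nn_integral_cmult) (simp_all add: nn_integral_schur_kernel that)
      also have "\<dots> = ennreal (pi / 2) * ennreal ((g s)\<^sup>2)"
        by (simp add: ennreal_mult'[symmetric])
      finally show ?thesis .
    qed
    hence "(\<integral>\<^sup>+s. \<integral>\<^sup>+t. ennreal (?k s t) \<partial>lborel_pos \<partial>lborel_pos)
      = (\<integral>\<^sup>+s. ennreal (pi / 2) * ennreal ((g s)\<^sup>2) \<partial>lborel_pos)"
      by (intro nn_integral_cong) (auto simp: space_restrict_space)
    thus ?thesis by (simp add: nn_integral_cmult)
  qed
  have "(\<integral>\<^sup>+s. \<integral>\<^sup>+t. ennreal (g s * g t / (s + t)) \<partial>lborel_pos \<partial>lborel_pos)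
      \<le> (\<integral>\<^sup>+s. \<integral>\<^sup>+t. ennreal (?k s t) + ennreal (?k t s) \<partial>lborel_pos \<partial>lborel_pos)"
  proof (intro nn_integral_mono)
    fix s t :: real
    assume "s \<in> space lborel_pos" "t \<in> space lborel_pos"
    hence st: "0 < s" "0 < t" by (auto simp: space_restrict_space)
    have "ennreal (g s * g t / (s + t)) \<le> ennreal (?k s t + ?k t s)"
      using pt[OF st] by (rule ennreal_leI)
    also have "\<dots> = ennreal (?k s t) + ennreal (?k t s)"
      using st by (intro ennreal_plus) auto
    finally show "ennreal (g s * g t / (s + t)) \<le> ennreal (?k s t) + ennreal (?k t s)" .
  qed
  also have "\<dots> = (\<integral>\<^sup>+s. \<integral>\<^sup>+t. ennreal (?k s t) \<partial>lborel_pos \<partial>lborel_pos)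
      + (\<integral>\<^sup>+s. \<integral>\<^sup>+t. ennreal (?k t s) \<partial>lborel_pos \<partial>lborel_pos)"
    by (simp add: nn_integral_add)
  also have "(\<integral>\<^sup>+s. \<integral>\<^sup>+t. ennreal (?k t s) \<partial>lborel_pos \<partial>lborel_pos)
      = (\<integral>\<^sup>+s. \<integral>\<^sup>+t. ennreal (?k s t) \<partial>lborel_pos \<partial>lborel_pos)"
    by (rule Fubini') measurable
  finally show ?thesis
    unfolding half by (simp add: distrib_right[symmetric] ennreal_plus[symmetric] del: ennreal_plus)
qed

section \<open>Hoelder's inequality and the bounds for nonnegative functions\<close>

text \<open>Hoelder's inequality with exponents 1 / (1 - \<theta>) and 1 / \<theta>: Young's
  inequality is applied pointwise to u / a and v / b, and after integration the two weights (1 -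
  \<theta>) K and \<theta> K add up to K.\<close>

lemma nn_integral_Young:
  fixes u v :: "'a \<Rightarrow> real"
  assumes [measurable]: "u \<in> borel_measurable M" "v \<in> borel_measurable M"
    and nonneg: "\<And>x. 0 \<le> u x" "\<And>x. 0 \<le> v x"
    and "0 \<le> \<theta>" "\<theta> \<le> 1" "0 < a" "0 < b"
    and le: "(\<integral>\<^sup>+x. ennreal (u x) \<partial>M) \<le> ennreal a" "(\<integral>\<^sup>+x. ennreal (v x) \<partial>M) \<le> ennreal b"
  shows "(\<integral>\<^sup>+x. ennreal (u x powr (1 - \<theta>) * v x powr \<theta>) \<partial>M) \<le> ennreal (a powr (1 - \<theta>) * b powr \<theta>)"
proof -
  define K where "K = a powr (1 - \<theta>) * b powr \<theta>"
  have "0 < K" using assms by (simp add: K_def)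
  have pt: "u x powr (1 - \<theta>) * v x powr \<theta> \<le> K * (1 - \<theta>) / a * u x + K * \<theta> / b * v x" for x
  proof (cases "u x = 0 \<or> v x = 0")
    \<comment> \<open>The left side vanishes, as \<open>0 powr y = 0\<close> even for y = 0; Young's
      inequality is left with positive arguments.\<close>
    case True
    thus ?thesis using assms \<open>0 < K\<close> by auto
  next
    case False
    hence pos: "0 < u x" "0 < v x" using nonneg[of x] by (auto simp: less_le)
    have "(u x / a) powr (1 - \<theta>) * (v x / b) powr \<theta> \<le> (1 - \<theta>) * (u x / a) + \<theta> * (v x / b)"
      using assms pos by (intro Youngs_inequality_0) auto
    hence "K * ((u x / a) powr (1 - \<theta>) * (v x / b) powr \<theta>) \<le> K * ((1 - \<theta>) * (u x / a) + \<theta> * (v x / b))"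
      using \<open>0 < K\<close> by (intro mult_left_mono) auto
    moreover have "K * ((u x / a) powr (1 - \<theta>) * (v x / b) powr \<theta>) = u x powr (1 - \<theta>) * v x powr \<theta>"
      using assms pos by (simp add: K_def powr_divide)
    ultimately show ?thesis by (simp add: algebra_simps)
  qed
  have "(\<integral>\<^sup>+x. ennreal (u x powr (1 - \<theta>) * v x powr \<theta>) \<partial>M)
      \<le> (\<integral>\<^sup>+x. ennreal (K * (1 - \<theta>) / a) * ennreal (u x) + ennreal (K * \<theta> / b) * ennreal (v x) \<partial>M)"
    using pt assms \<open>0 < K\<close>
    by (intro nn_integral_mono) (simp add: ennreal_mult''[symmetric] ennreal_plus[symmetric] ennreal_leI del: ennreal_plus)
  also have "\<dots> = ennreal (K * (1 - \<theta>) / a) * (\<integral>\<^sup>+x. ennreal (u x) \<partial>M)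
      + ennreal (K * \<theta> / b) * (\<integral>\<^sup>+x. ennreal (v x) \<partial>M)"
    by (simp add: nn_integral_add nn_integral_cmult)
  also have "\<dots> \<le> ennreal (K * (1 - \<theta>) / a) * ennreal a + ennreal (K * \<theta> / b) * ennreal b"
    by (intro add_mono mult_left_mono le) auto
  also have "\<dots> = ennreal K"
    proof -
    have "K * (1 - \<theta>) / a * a + K * \<theta> / b * b = K" using assms by (simp add: right_diff_distrib)
    thus ?thesis
      using assms \<open>0 < K\<close> by (simp add: ennreal_mult''[symmetric] ennreal_plus[symmetric] del: ennreal_plus)
  qed
  finally show ?thesis unfolding K_def .
qed

text \<open>With values in \<open>ennreal\<close>, Tonelli applies before any convergence is known.
  The argument stays complex so that the result can be integrated over the plane.\<close>

definition real_laplace :: "(real \<Rightarrow> real) \<Rightarrow> complex \<Rightarrow> ennreal" where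
  "real_laplace g z = (\<integral>\<^sup>+t. ennreal (g t * exp (- t * Re z)) \<partial>lborel_pos)"

lemma borel_measurable_real_laplace:
  assumes [measurable]: "g \<in> borel_measurable lborel_pos"
  shows "real_laplace g \<in> borel_measurable borel"
proof -
  interpret N: sigma_finite_measure lborel_pos by (rule sigma_finite_lborel_pos)
  have id[measurable]: "(\<lambda>t. t) \<in> borel_measurable lborel_pos"
    by (simp add: measurable_restrict_space1)
  have [measurable]: "snd \<in> borel_measurable (borel \<Otimes>\<^sub>M lborel_pos)"
    by (rule measurable_compose[OF measurable_snd id])
  have "(\<lambda>z. \<integral>\<^sup>+t. ennreal (g t * exp (- t * Re z)) \<partial>lborel_pos) \<in> borel_measurable borel"
    by (rule N.borel_measurable_nn_integral) measurable
  thus ?thesis unfolding real_laplace_def[abs_def] .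
qed

text \<open>The square is a double integral over s and t. Opening one factor at a time and moving
  the z-integral inside each time leaves the integral of \<open>exp (- (s + t) * Re z)\<close>,
  which is at most D / (s + t); Hilbert's inequality finishes.\<close>

lemma real_laplace_L2:
  fixes M :: "complex measure" and g :: "real \<Rightarrow> real"
  assumes sets: "sets M = sets borel"
    and pos: "AE z in M. 0 \<le> Re z"
    and bound: "\<And>X. 0 < X \<Longrightarrow> emeasure M {z. Re z < X} \<le> ennreal (D * X)"
    and "0 \<le> D"
    and g[measurable]: "g \<in> borel_measurable lborel_pos" and nonneg: "\<And>t. 0 \<le> g t"
  shows "(\<integral>\<^sup>+z. (real_laplace g z)\<^sup>2 \<partial>M) \<le> ennreal (pi * D) * (\<integral>\<^sup>+t. ennreal ((g t)\<^sup>2) \<partial>lborel_pos)"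
proof -
  interpret N: sigma_finite_measure lborel_pos by (rule sigma_finite_lborel_pos)
  interpret M: sigma_finite_measure M using sets bound by (rule sigma_finite_half_planes)
  interpret pair_sigma_finite lborel_pos M ..
  note [measurable_cong] = sets
  have id[measurable]: "(\<lambda>t. t) \<in> borel_measurable lborel_pos"
    by (simp add: measurable_restrict_space1)
  have [measurable]: "Re \<in> borel_measurable M"
    by (subst measurable_cong_sets[OF sets refl]) (intro borel_measurable_continuous_onI continuous_intros)
  have [measurable]: "fst \<in> borel_measurable (lborel_pos \<Otimes>\<^sub>M M)"
    by (rule measurable_compose[OF measurable_fst id])
  define k where "k s z = g s * exp (- s * Re z)" for s z
  note borel_measurable_real_laplace[OF g, measurable]
  have meas2: "(\<lambda>(s, z). ennreal (k s z) * real_laplace g z) \<in> borel_measurable (lborel_pos \<Otimes>\<^sub>M M)"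
    "(\<lambda>(t, z). ennreal (k s z) * ennreal (k t z)) \<in> borel_measurable (lborel_pos \<Otimes>\<^sub>M M)" for s
    unfolding k_def by measurable
  have k_meas: "(\<lambda>s. ennreal (k s z)) \<in> borel_measurable lborel_pos" "(\<lambda>z. ennreal (k s z)) \<in> borel_measurable M"
    for s z unfolding k_def by measurable
  have kk: "ennreal (k s z) * ennreal (k t z) = ennreal (g s * g t) * ennreal (exp (- (s + t) * Re z))" for s t z
  proof -
    have "exp (- (s + t) * Re z) = exp (- s * Re z) * exp (- t * Re z)"
      by (subst exp_add[symmetric]) (simp add: algebra_simps)
    hence "k s z * k t z = g s * g t * exp (- (s + t) * Re z)" by (simp add: k_def)
    thus ?thesis using nonneg by (simp add: k_def ennreal_mult'[symmetric])
  qed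
  have "(\<integral>\<^sup>+z. (real_laplace g z)\<^sup>2 \<partial>M) = (\<integral>\<^sup>+z. (\<integral>\<^sup>+s. ennreal (k s z) * real_laplace g z \<partial>lborel_pos) \<partial>M)"
    by (intro nn_integral_cong) (simp add: k_meas nn_integral_multc power2_eq_square, simp add: real_laplace_def k_def)
  also have "\<dots> = (\<integral>\<^sup>+s. (\<integral>\<^sup>+z. ennreal (k s z) * real_laplace g z \<partial>M) \<partial>lborel_pos)"
    by (intro Fubini' meas2)
  also have "\<dots> = (\<integral>\<^sup>+s. (\<integral>\<^sup>+z. (\<integral>\<^sup>+t. ennreal (k s z) * ennreal (k t z) \<partial>lborel_pos) \<partial>M) \<partial>lborel_pos)"
    by (intro nn_integral_cong) (simp add: k_meas nn_integral_cmult, simp add: real_laplace_def k_def)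
  also have "\<dots> = (\<integral>\<^sup>+s. (\<integral>\<^sup>+t. (\<integral>\<^sup>+z. ennreal (k s z) * ennreal (k t z) \<partial>M) \<partial>lborel_pos) \<partial>lborel_pos)"
    by (intro nn_integral_cong Fubini' meas2)
  also have "\<dots> \<le> (\<integral>\<^sup>+s. (\<integral>\<^sup>+t. ennreal D * ennreal (g s * g t / (s + t)) \<partial>lborel_pos) \<partial>lborel_pos)"
  proof (intro nn_integral_mono)
    fix s t :: real
    assume "s \<in> space lborel_pos" "t \<in> space lborel_pos"
    hence st: "0 < s + t" by (auto simp: space_restrict_space)
    have "(\<integral>\<^sup>+z. ennreal (k s z) * ennreal (k t z) \<partial>M)
        = ennreal (g s * g t) * (\<integral>\<^sup>+z. ennreal (exp (- (s + t) * Re z)) \<partial>M)"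
      unfolding kk by (rule nn_integral_cmult) measurable
    also have "\<dots> \<le> ennreal (g s * g t) * ennreal (D / (s + t))"
      by (intro mult_left_mono nn_integral_exp_Re[OF sets pos bound st]) auto
    also have "\<dots> = ennreal D * ennreal (g s * g t / (s + t))"
      using st nonneg \<open>0 \<le> D\<close> by (simp add: ennreal_mult'[symmetric] ac_simps)
    finally show "(\<integral>\<^sup>+z. ennreal (k s z) * ennreal (k t z) \<partial>M) \<le> ennreal D * ennreal (g s * g t / (s + t))" .
  qed
  also have "\<dots> = ennreal D * (\<integral>\<^sup>+s. (\<integral>\<^sup>+t. ennreal (g s * g t / (s + t)) \<partial>lborel_pos) \<partial>lborel_pos)"
  proof -
    have [measurable]: "fst \<in> borel_measurable (lborel_pos \<Otimes>\<^sub>M lborel_pos)" "snd \<in> borel_measurable (lborel_pos \<Otimes>\<^sub>M lborel_pos)"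
      by (rule measurable_compose[OF measurable_fst id] measurable_compose[OF measurable_snd id])+
    have "(\<lambda>s. \<integral>\<^sup>+t. ennreal (g s * g t / (s + t)) \<partial>lborel_pos) \<in> borel_measurable lborel_pos"
      by (rule N.borel_measurable_nn_integral) measurable
    thus ?thesis by (simp add: nn_integral_cmult)
  qed
  also have "\<dots> \<le> ennreal D * (ennreal pi * (\<integral>\<^sup>+t. ennreal ((g t)\<^sup>2) \<partial>lborel_pos))"
    by (intro mult_left_mono hilbert_inequality g nonneg) auto
  also have "\<dots> = ennreal (pi * D) * (\<integral>\<^sup>+t. ennreal ((g t)\<^sup>2) \<partial>lborel_pos)"
    using \<open>0 \<le> D\<close> by (simp add: ennreal_mult ac_simps)
  finally show ?thesis .
qed

text \<open>The function \<open>h = g powr (p / 2)\<close> satisfies h^2 = g^p, so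
  \<open>real_laplace_L2\<close> applies to it. The factor from g^p is at most J pointwise, and
  since \<theta> q = 2 the q-th power of the pointwise bound is J^(q - 2) times the square
  controlled in L^2. Finiteness is a separate conclusion because \<open>enn2real\<close> maps
  infinity to 0 and would hide divergence in the integral.\<close>

lemma real_laplace_interpolation:
  fixes M :: "complex measure" and g :: "real \<Rightarrow> real" and p q J :: real
  assumes sets: "sets M = sets borel"
    and pos: "AE z in M. 0 \<le> Re z"
    and bound: "\<And>X. 0 < X \<Longrightarrow> emeasure M {z. Re z < X} \<le> ennreal (D * X)"
    and "0 \<le> D" and p: "1 < p" "p \<le> 2" "1 / p + 1 / q = 1"
    and g[measurable]: "g \<in> borel_measurable lborel_pos" and nonneg: "\<And>t. 0 \<le> g t"
    and J: "(\<integral>\<^sup>+t. ennreal (g t powr p) \<partial>lborel_pos) = ennreal J" "0 \<le> J"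
  shows "AE z in M. real_laplace g z < \<infinity>"
    and "(\<integral>\<^sup>+z. ennreal (enn2real (real_laplace g z) powr q) \<partial>M) \<le> ennreal (pi * D * J powr (q - 1))"
proof -
  have q: "2 \<le> q" "q = p / (p - 1)" proof -
    have "q \<noteq> 0" using p by (cases "q = 0") auto
    hence "q * (p - 1) = p" using p by (simp add: field_simps)
    thus "q = p / (p - 1)" using p by (simp add: field_simps)
    thus "2 \<le> q" using p(1,2) by (simp add: le_divide_eq)
  qed
  define h where "h t = g t powr (p / 2)" for t
  have h[measurable]: "h \<in> borel_measurable lborel_pos" unfolding h_def[abs_def] by measurable
  have h0: "0 \<le> h t" for t by (simp add: h_def)
  have hsq: "(h t)\<^sup>2 = g t powr p" for t
    using nonneg[of t] by (simp add: h_def power2_eq_square powr_add[symmetric])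
  have L2: "(\<integral>\<^sup>+z. (real_laplace h z)\<^sup>2 \<partial>M) \<le> ennreal (pi * D * J)"
    using real_laplace_L2[OF sets pos bound \<open>0 \<le> D\<close> h h0] J \<open>0 \<le> D\<close>
    by (simp add: hsq ennreal_mult'[symmetric])
  have [measurable]: "(\<lambda>z. (real_laplace h z)\<^sup>2) \<in> borel_measurable M"
    unfolding measurable_cong_sets[OF sets refl] power2_eq_square
    by (intro borel_measurable_times_ennreal borel_measurable_real_laplace h)
  have fin: "AE z in M. real_laplace h z < \<infinity>"
  proof -
    have "AE z in M. (real_laplace h z)\<^sup>2 \<noteq> \<infinity>"
      using L2 by (intro nn_integral_PInf_AE) (auto simp: top_unique)
    thus ?thesis by eventually_elim (auto simp: power2_eq_square ennreal_mult_eq_top_iff less_top)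
  qed
  define \<theta> where "\<theta> = 2 / q"
  have \<theta>: "0 \<le> \<theta>" "\<theta> \<le> 1" using q(1) by (simp_all add: \<theta>_def)
  have "1 / q = 1 - 1 / p" using p(3) by linarith
  moreover have "p * (1 - \<theta>) + p / 2 * \<theta> = p * (1 - 1 / q)"
    by (simp add: \<theta>_def right_diff_distrib)
  \<comment> \<open>The first identity lets the two powers of g recombine to g itself; it is the
    conjugacy of p and q in disguise.\<close>
  ultimately have exps: "p * (1 - \<theta>) + p / 2 * \<theta> = 1" "\<theta> * q = 2" "(1 - \<theta>) * q = q - 2" "1 - \<theta> + \<theta> = 1"
    using p(1) q(1) by (simp_all add: \<theta>_def left_diff_distrib)
  have pt: "real_laplace g z \<le> ennreal (J powr (1 - \<theta>) * enn2real (real_laplace h z) powr \<theta>)"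
    if z: "0 \<le> Re z" "real_laplace h z < \<infinity>" for z
  proof -
    let ?e = "\<lambda>t. exp (- t * Re z)"
    have split: "g t * ?e t = (g t powr p * ?e t) powr (1 - \<theta>) * (h t * ?e t) powr \<theta>" for t
    proof (cases "g t = 0")
      case False
      hence "0 < g t" using nonneg[of t] by simp
      have "(g t powr p * ?e t) powr (1 - \<theta>) * (h t * ?e t) powr \<theta>
          = (g t powr (p * (1 - \<theta>)) * g t powr (p / 2 * \<theta>)) * (?e t powr (1 - \<theta>) * ?e t powr \<theta>)"
        using nonneg[of t] by (simp add: powr_mult h_def powr_powr)
      also have "\<dots> = g t powr (p * (1 - \<theta>) + p / 2 * \<theta>) * ?e t powr (1 - \<theta> + \<theta>)"
        by (simp only: powr_add)
      finally show ?thesis unfolding exps using \<open>0 < g t\<close> by simp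
    qed (simp add: h_def)
    have [measurable]: "(\<lambda>t. t) \<in> borel_measurable lborel_pos"
      by (simp add: measurable_restrict_space1)
    have le1: "(\<integral>\<^sup>+t. ennreal (g t powr p * ?e t) \<partial>lborel_pos) \<le> ennreal J"
      unfolding J(1)[symmetric] using z
      by (intro nn_integral_mono ennreal_leI) (auto simp: space_restrict_space intro!: mult_left_le)
    have le2: "(\<integral>\<^sup>+t. ennreal (h t * ?e t) \<partial>lborel_pos) = ennreal (enn2real (real_laplace h z))"
      using z(2) by (simp add: real_laplace_def less_top)
    show ?thesis
    proof (cases "J = 0 \<or> enn2real (real_laplace h z) = 0")
      case False
      hence "0 < J" "0 < enn2real (real_laplace h z)" using J(2) by (auto simp: less_le)
      thus ?thesis
        unfolding real_laplace_def[of g] split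
        by (intro nn_integral_Young \<theta> le1 eq_refl[OF le2]) (auto simp: h0)
    next
      \<comment> \<open>\<open>nn_integral_Young\<close> needs positive bounds. If one of them is 0,
        then g vanishes almost everywhere.\<close>
      case True
      have "AE t in lborel_pos. g t = 0"
      proof (cases "J = 0")
        case True
        hence "(\<integral>\<^sup>+t. ennreal (g t powr p) \<partial>lborel_pos) = 0" using J by simp
        hence "AE t in lborel_pos. ennreal (g t powr p) = 0" by (subst (asm) nn_integral_0_iff_AE) simp_all
        thus ?thesis by eventually_elim (metis ennreal_eq_0_iff powr_ge_zero powr_eq_0_iff order_antisym)
      next
        case False
        hence "(\<integral>\<^sup>+t. ennreal (h t * ?e t) \<partial>lborel_pos) = 0" using True le2 by simp
        hence "AE t in lborel_pos. ennreal (h t * ?e t) = 0" by (subst (asm) nn_integral_0_iff_AE) simp_all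
        thus ?thesis by eventually_elim (auto simp: h_def ennreal_eq_0_iff mult_le_0_iff)
      qed
      hence "real_laplace g z = (\<integral>\<^sup>+t. 0 \<partial>lborel_pos)"
        unfolding real_laplace_def by (intro nn_integral_cong_AE) auto
      thus ?thesis by simp
    qed
  qed
  show "AE z in M. real_laplace g z < \<infinity>"
    using fin pos 
  proof eventually_elim
    case (elim z)
    thus ?case by (intro le_less_trans[OF pt]) auto
  qed
  have "(\<integral>\<^sup>+z. ennreal (enn2real (real_laplace g z) powr q) \<partial>M)
      \<le> (\<integral>\<^sup>+z. ennreal (J powr (q - 2)) * (real_laplace h z)\<^sup>2 \<partial>M)"
  proof (intro nn_integral_mono_AE, use fin pos in eventually_elim)
    fix z assume z: "real_laplace h z < \<infinity>" "0 \<le> Re z"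
    define b where "b = enn2real (real_laplace h z)"
    have b: "real_laplace h z = ennreal b" "0 \<le> b" using z by (auto simp: b_def)
    have "enn2real (real_laplace g z) \<le> J powr (1 - \<theta>) * b powr \<theta>"
      using pt[OF z(2,1)] unfolding b_def by (intro enn2real_leI) auto
    hence "enn2real (real_laplace g z) powr q \<le> (J powr (1 - \<theta>) * b powr \<theta>) powr q"
      using q by (intro powr_mono2) auto
    also have "\<dots> = J powr (q - 2) * b\<^sup>2"
      using b by (simp add: powr_mult powr_powr exps)
    finally show "ennreal (enn2real (real_laplace g z) powr q) \<le> ennreal (J powr (q - 2)) * (real_laplace h z)\<^sup>2"
      unfolding b(1) using b(2) by (simp add: ennreal_mult'[symmetric] ennreal_power ennreal_leI)
  qed
  also have "\<dots> = ennreal (J powr (q - 2)) * (\<integral>\<^sup>+z. (real_laplace h z)\<^sup>2 \<partial>M)"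
    by (rule nn_integral_cmult) measurable
  also have "\<dots> \<le> ennreal (J powr (q - 2)) * ennreal (pi * D * J)"
    by (intro mult_left_mono L2) auto
  also have "\<dots> = ennreal (pi * D * J powr (q - 1))"
  proof -
    have "J powr (q - 2) * J = J powr (q - 1)"
      using J(2) powr_add[of J "q - 2" 1] by (cases "J = 0") auto
    thus ?thesis using \<open>0 \<le> D\<close> J(2) by (simp add: ennreal_mult'[symmetric] mult.left_commute)
  qed
  finally show "(\<integral>\<^sup>+z. ennreal (enn2real (real_laplace g z) powr q) \<partial>M) \<le> ennreal (pi * D * J powr (q - 1))" .
qed

section \<open>Length and arclength measure\<close>

text \<open>The sum inside \<open>curve_length_def\<close>, made recursive for list induction and
  real-valued so that continuity and the triangle inequality apply.\<close>

fun polygon_length :: "('a \<Rightarrow> 'b::metric_space) \<Rightarrow> 'a list \<Rightarrow> real" where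
  "polygon_length g (x # y # zs) = dist (g x) (g y) + polygon_length g (y # zs)"
| "polygon_length g _ = 0"

lemma polygon_length_nonneg: "0 \<le> polygon_length g ts"
  by (induction g ts rule: polygon_length.induct) auto

lemma polygon_length_sum:
  "polygon_length g ts = (\<Sum>i<length ts - 1. dist (g (ts ! i)) (g (ts ! Suc i)))"
proof (induction g ts rule: polygon_length.induct)
  case (1 g x y zs)
  thus ?case by (simp add: sum.lessThan_Suc_shift del: sum.lessThan_Suc)
qed auto

lemma polygon_length_append_ge:
  "polygon_length g ts + polygon_length g us \<le> polygon_length g (ts @ us)"
proof (induction g ts rule: polygon_length.induct)
  case ("2_2" g x)
  show ?case by (cases us) auto
qed auto

lemma polygon_length_append_le:
  "polygon_length g (xs @ ys) \<le> polygon_length g (xs @ [a]) + polygon_length g (a # ys)"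
proof (induction g xs rule: polygon_length.induct)
  case ("2_1" g)
  show ?case by (cases ys) auto
next
  case ("2_2" g x)
  show ?case
  proof (cases ys)
    case (Cons y zs)
    thus ?thesis using dist_triangle[of "g x" "g y" "g a"] by simp
  qed auto
qed auto

lemma curve_length_polygon:
  fixes g :: "real \<Rightarrow> complex"
  shows "curve_length g S = (SUP ts\<in>{ts. sorted ts \<and> set ts \<subseteq> S}. ennreal (polygon_length g ts))"
  unfolding curve_length_def polygon_length_sum by simp

lemma polygon_length_le_curve_length:
  "sorted ts \<Longrightarrow> set ts \<subseteq> S \<Longrightarrow> ennreal (polygon_length g ts) \<le> curve_length g S"
  unfolding curve_length_polygon by (rule SUP_upper) auto

lemma curve_length_leI:
  "(\<And>ts. sorted ts \<Longrightarrow> set ts \<subseteq> S \<Longrightarrow> ennreal (polygon_length g ts) \<le> L) \<Longrightarrow> curve_length g S \<le> L"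
  unfolding curve_length_polygon by (rule SUP_least) auto

lemma curve_length_mono: "S \<subseteq> T \<Longrightarrow> curve_length g S \<le> curve_length g T"
  by (rule curve_length_leI) (auto intro: polygon_length_le_curve_length)

text \<open>Concatenating a polygon before t with one after t gives an inscribed polygon with an
  additional edge. The set S is arbitrary because it will be the part of a curve inside a
  half-plane, which may have gaps.\<close>

lemma curve_length_superadditive:
  "curve_length g (S \<inter> {..t}) + curve_length g (S \<inter> {t..}) \<le> curve_length g S"
proof -
  let ?A = "\<lambda>T. {ts. sorted ts \<and> set ts \<subseteq> T}"
  have ne: "?A T \<noteq> {}" for T by (auto intro!: exI[of _ "[]"])
  have "ennreal (polygon_length g ts) + ennreal (polygon_length g us) \<le> curve_length g S"
    if "ts \<in> ?A (S \<inter> {..t})" "us \<in> ?A (S \<inter> {t..})" for ts us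
  proof -
    have "sorted (ts @ us)" "set (ts @ us) \<subseteq> S"
      using that by (fastforce simp: sorted_append)+
    hence "ennreal (polygon_length g (ts @ us)) \<le> curve_length g S"
      by (rule polygon_length_le_curve_length)
    moreover have "ennreal (polygon_length g ts) + ennreal (polygon_length g us)
        \<le> ennreal (polygon_length g (ts @ us))"
      by (simp add: ennreal_plus[symmetric] polygon_length_nonneg polygon_length_append_ge ennreal_leI del: ennreal_plus)
    ultimately show ?thesis by (rule order_trans[rotated])
  qed
  hence "(SUP ts\<in>?A (S \<inter> {..t}). SUP us\<in>?A (S \<inter> {t..}). ennreal (polygon_length g ts) + ennreal (polygon_length g us))
      \<le> curve_length g S"
    by (intro SUP_least)
  thus ?thesis
    unfolding curve_length_polygon[of g "S \<inter> {..t}"] curve_length_polygon[of g "S \<inter> {t..}"]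
    by (simp only: ennreal_SUP_add_left[OF ne] ennreal_SUP_add_right[OF ne, symmetric])
qed

lemma sorted_split_at:
  "sorted ts \<Longrightarrow> ts = filter (\<lambda>x. x \<le> a) ts @ filter (\<lambda>x. a < (x::'a::linorder)) ts"
proof (induction ts)
  case (Cons x ts)
  show ?case
  proof (cases "x \<le> a")
    case False
    hence "filter (\<lambda>x. x \<le> a) ts = []" "filter (\<lambda>x. a < x) ts = ts"
      using Cons.prems by (auto simp: filter_empty_conv filter_id_conv)
    thus ?thesis using False by simp
  qed (use Cons in auto)
qed simp

text \<open>Inserting \<open>a\<close> as a vertex does not shorten a polygon. The point must be a
  parameter of the curve, for otherwise an edge across \<open>a\<close> could not be split.\<close>

lemma curve_length_subadditive:
  assumes "a \<in> I" "a \<le> b"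
  shows "curve_length g (I \<inter> {..b}) \<le> curve_length g (I \<inter> {..a}) + curve_length g (I \<inter> {a..b})"
proof (rule curve_length_leI)
  fix ts assume ts: "sorted ts" "set ts \<subseteq> I \<inter> {..b}"
  define xs ys where "xs = filter (\<lambda>x. x \<le> a) ts" and "ys = filter (\<lambda>x. a < x) ts"
  have "ts = xs @ ys" unfolding xs_def ys_def by (rule sorted_split_at[OF ts(1)])
  have "sorted (xs @ [a])" "set (xs @ [a]) \<subseteq> I \<inter> {..a}" "sorted (a # ys)" "set (a # ys) \<subseteq> I \<inter> {a..b}"
    using ts assms by (auto simp: xs_def ys_def sorted_append sorted_filter[where f=id, simplified])
  hence "ennreal (polygon_length g (xs @ [a])) + ennreal (polygon_length g (a # ys))
      \<le> curve_length g (I \<inter> {..a}) + curve_length g (I \<inter> {a..b})"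
    by (intro add_mono polygon_length_le_curve_length)
  moreover have "ennreal (polygon_length g ts) \<le> ennreal (polygon_length g (xs @ [a])) + ennreal (polygon_length g (a # ys))"
    unfolding \<open>ts = xs @ ys\<close>
    by (simp add: ennreal_plus[symmetric] polygon_length_nonneg polygon_length_append_le ennreal_leI del: ennreal_plus polygon_length.simps)
  ultimately show "ennreal (polygon_length g ts) \<le> curve_length g (I \<inter> {..a}) + curve_length g (I \<inter> {a..b})"
    by (rule order_trans[rotated])
qed

text \<open>Clamping all vertices to at least \<tau>, with \<tau> slightly above t, moves a polygon
  off the left endpoint, and its length depends continuously on \<tau>. This is where
  right-continuity of the length function comes from.\<close>

lemma curve_length_remove_left:
  fixes g :: "real \<Rightarrow> complex"
  assumes "is_interval I" "continuous_on I g" "t \<in> I" "s \<in> I" "t < s"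
  shows "curve_length g (I \<inter> {t..s}) \<le> curve_length g (I \<inter> {t<..s})"
proof (rule curve_length_leI)
  fix ts assume ts: "sorted ts" "set ts \<subseteq> I \<inter> {t..s}"
  have sub: "{t..s} \<subseteq> I" using mem_is_interval_1_I[OF assms(1,3,4)] by auto
  define f where "f \<tau> = polygon_length g (map (max \<tau>) ts)" for \<tau>
  have contg: "continuous_on {t..s} (\<lambda>\<tau>. g (max \<tau> x))" if "x \<in> {t..s}" for x
    using that sub
    by (intro continuous_on_compose2[OF assms(2)] continuous_intros) (auto simp: max_def)
  have f_sum: "f = (\<lambda>\<tau>. \<Sum>i<length ts - 1. dist (g (max \<tau> (ts ! i))) (g (max \<tau> (ts ! Suc i))))"
    unfolding f_def polygon_length_sum by (intro ext) simp
  have "ts ! i \<in> {t..s}" if "i < length ts" for i using ts(2) nth_mem[OF that] by auto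
  hence "continuous_on {t..s} f"
    unfolding f_sum by (intro continuous_on_sum continuous_on_dist contg) auto
  hence "(f \<longlongrightarrow> f t) (at_right t)" using \<open>t < s\<close> by (rule continuous_on_Icc_at_rightD)
  hence "((\<lambda>\<tau>. ennreal (f \<tau>)) \<longlongrightarrow> ennreal (f t)) (at_right t)" by (rule tendsto_ennrealI)
  moreover have "eventually (\<lambda>\<tau>. ennreal (f \<tau>) \<le> curve_length g (I \<inter> {t<..s})) (at_right t)"
    using eventually_at_right_less[of t] eventually_at_right_real[OF \<open>t < s\<close>]
  proof eventually_elim
    case (elim \<tau>)
    have "sorted (map (max \<tau>) ts)"
      using ts(1) by (auto simp: sorted_iff_nth_mono max_def intro: order_trans)
    moreover have "set (map (max \<tau>) ts) \<subseteq> I \<inter> {t<..s}"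
      using elim ts(2) sub by (auto simp: max_def)
    ultimately show ?case unfolding f_def by (rule polygon_length_le_curve_length)
  qed
  ultimately have "ennreal (f t) \<le> curve_length g (I \<inter> {t<..s})"
    by (intro tendsto_upperbound) auto
  moreover have "map (max t) ts = ts" using ts(2) by (intro map_idI) (auto simp: max_def)
  ultimately show "ennreal (polygon_length g ts) \<le> curve_length g (I \<inter> {t<..s})" by (simp add: f_def)
qed

section \<open>The length function and its Stieltjes measure\<close>

definition arclength_upto :: "curve \<Rightarrow> real \<Rightarrow> real" where
  "arclength_upto \<gamma> t = enn2real (curve_length (snd \<gamma>) (fst \<gamma> \<inter> {..t}))"

lemma ennreal_arclength_upto:
  "rectifiable \<gamma> \<Longrightarrow> ennreal (arclength_upto \<gamma> t) = curve_length (snd \<gamma>) (fst \<gamma> \<inter> {..t})"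
  unfolding arclength_upto_def rectifiable_def
  by (metis Int_lower1 curve_length_mono ennreal_enn2real order_le_less_trans infinity_ennreal_def)

lemma arclength_upto_nonneg: "0 \<le> arclength_upto \<gamma> t"
  by (simp add: arclength_upto_def)

lemma arclength_upto_mono:
  assumes "rectifiable \<gamma>" "s \<le> t"
  shows "arclength_upto \<gamma> s \<le> arclength_upto \<gamma> t"
proof -
  have "ennreal (arclength_upto \<gamma> s) \<le> ennreal (arclength_upto \<gamma> t)"
    unfolding ennreal_arclength_upto[OF assms(1)] using assms(2) by (intro curve_length_mono) auto
  thus ?thesis by (simp add: arclength_upto_nonneg)
qed

text \<open>The formula for the Stieltjes measure of \<open>{a<..b}\<close> depends on this. A
  polygon to the right of t that almost exhausts the length there leaves length at most e before its
  first vertex u; passing from \<open>{t<..u}\<close> to \<open>{t..u}\<close> adds nothing by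
  continuity of the curve.\<close>

lemma arclength_upto_continuous_right:
  assumes rect: "rectifiable \<gamma>"
  shows "continuous (at_right t) (arclength_upto \<gamma>)"
proof -
  obtain I g where \<gamma>: "\<gamma> = (I, g)" by (cases \<gamma>)
  have I: "is_interval I" and g: "continuous_on I g" and fin: "curve_length g I < \<infinity>"
    using rect by (auto simp: rectifiable_def is_curve_def \<gamma>)
  define S where "S = I \<inter> {t<..}"
  have near: "\<exists>u>t. \<forall>s\<in>{t<..<u}. arclength_upto \<gamma> s \<le> arclength_upto \<gamma> t + e" if "0 < e" for e
  proof (cases "S = {}")
    case True
    hence "I \<inter> {..s} = I \<inter> {..t}" if "t < s" for s using that by (force simp: S_def)
    thus ?thesis using \<open>0 < e\<close> by (intro exI[of _ "t + 1"]) (auto simp: arclength_upto_def \<gamma>)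
  next
    case False
    have finS: "curve_length g S < \<infinity>"
      using curve_length_mono[of S I g] fin by (auto simp: S_def)
    obtain u where u: "u \<in> S" "curve_length g (S \<inter> {..u}) \<le> ennreal e"
    proof (cases "curve_length g S \<le> ennreal e")
      case True
      obtain u where "u \<in> S" using False by auto
      moreover have "curve_length g (S \<inter> {..u}) \<le> ennreal e"
        using curve_length_mono[of "S \<inter> {..u}" S g] True by (auto intro: order_trans)
      ultimately show ?thesis by (rule that)
    next
      case False
      \<comment> \<open>Here the almost exhausting polygon is chosen. It has a first vertex because
        the empty polygon has length 0, and superadditivity at that vertex bounds what lies before
        it.\<close>
      hence "curve_length g S - ennreal e < curve_length g S"
        using finS \<open>0 < e\<close> by (intro ennreal_between) (auto simp: less_top zero_less_iff_neq_zero)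
      then obtain ts where ts: "sorted ts" "set ts \<subseteq> S" "curve_length g S - ennreal e < ennreal (polygon_length g ts)"
        unfolding curve_length_polygon[of g S] less_SUP_iff by auto
      from ts(3) obtain u us where us: "ts = u # us" by (cases ts) auto
      have "ennreal (polygon_length g ts) \<le> curve_length g (S \<inter> {u..})"
        using ts(1,2) by (intro polygon_length_le_curve_length) (auto simp: us)
      hence "curve_length g (S \<inter> {..u}) + ennreal (polygon_length g ts) \<le> curve_length g S"
        using curve_length_superadditive[of g S u] by (meson add_left_mono order_trans)
      moreover have "curve_length g S \<le> ennreal e + ennreal (polygon_length g ts)"
        using ts(3) by (metis ennreal_minus_le_iff less_imp_le)
      ultimately have "curve_length g (S \<inter> {..u}) + ennreal (polygon_length g ts) \<le> ennreal e + ennreal (polygon_length g ts)"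
        by (rule order_trans)
      hence "curve_length g (S \<inter> {..u}) \<le> ennreal e" by (simp add: ennreal_add_left_cancel_le add.commute)
      moreover have "u \<in> S" using ts(2) us by simp
      ultimately show ?thesis by (rule that[rotated])
    qed
    have uI: "u \<in> I" "t < u" and Su: "S \<inter> {..u} = I \<inter> {t<..u}" using u(1) by (auto simp: S_def)
    have "curve_length g (I \<inter> {..u}) \<le> curve_length g (I \<inter> {..t}) + ennreal e"
    proof (cases "t \<in> I")
      case True
      have "curve_length g (I \<inter> {..u}) \<le> curve_length g (I \<inter> {..t}) + curve_length g (I \<inter> {t..u})"
        using True uI by (intro curve_length_subadditive) auto
      also have "curve_length g (I \<inter> {t..u}) \<le> curve_length g (I \<inter> {t<..u})"
        using I g True uI by (intro curve_length_remove_left)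
      also have "\<dots> \<le> ennreal e" using u(2) Su by simp
      finally show ?thesis by (simp add: add_left_mono)
    next
      case False
      \<comment> \<open>An interval that contains u > t but not t lies entirely to the right of
        t.\<close>
      hence "I \<inter> {..u} = S \<inter> {..u}"
        unfolding Su using mem_is_interval_1_I[OF I, of _ u t] uI by fastforce
      thus ?thesis using u(2) by (simp add: add_increasing)
    qed
    hence "ennreal (arclength_upto \<gamma> u) \<le> ennreal (arclength_upto \<gamma> t + e)"
      using ennreal_arclength_upto[OF rect] \<open>0 < e\<close> by (simp add: \<gamma> arclength_upto_nonneg)
    hence "arclength_upto \<gamma> u \<le> arclength_upto \<gamma> t + e"
      using \<open>0 < e\<close> by (subst (asm) ennreal_le_iff) (auto simp: arclength_upto_nonneg)
    thus ?thesis
      using uI(2) by (intro exI[of _ u]) (auto intro: order_trans[OF arclength_upto_mono[OF rect less_imp_le]])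
  qed
  have "(arclength_upto \<gamma> \<longlongrightarrow> arclength_upto \<gamma> t) (at_right t)"
  proof (rule tendstoI)
    fix e :: real assume "0 < e"
    obtain u where u: "t < u" "\<forall>s\<in>{t<..<u}. arclength_upto \<gamma> s \<le> arclength_upto \<gamma> t + e / 2"
      using near[of "e / 2"] \<open>0 < e\<close> by auto
    have "dist (arclength_upto \<gamma> s) (arclength_upto \<gamma> t) < e" if "t < s" "s < u" for s
      using u(2) that arclength_upto_mono[OF rect, of t s] \<open>0 < e\<close> by (force simp: dist_real_def)
    thus "eventually (\<lambda>s. dist (arclength_upto \<gamma> s) (arclength_upto \<gamma> t) < e) (at_right t)"
      unfolding eventually_at_right_field using u(1) by blast
  qed
  thus ?thesis by (simp add: continuous_within)
qed

text \<open>Only an upper bound is wanted, so subadditivity at \<open>a\<close> suffices; if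
  \<open>a\<close> is not a parameter, the parameter interval lies on one side of it.\<close>

lemma emeasure_arclength_Ioc:
  assumes rect: "rectifiable \<gamma>" and "a \<le> b"
  shows "emeasure (interval_measure (arclength_upto \<gamma>)) {a<..b} \<le> curve_length (snd \<gamma>) (fst \<gamma> \<inter> {a..b})"
proof -
  obtain I g where \<gamma>: "\<gamma> = (I, g)" by (cases \<gamma>)
  have I: "is_interval I" using rect by (auto simp: rectifiable_def is_curve_def \<gamma>)
  have "curve_length g (I \<inter> {..b}) \<le> curve_length g (I \<inter> {..a}) + curve_length g (I \<inter> {a..b})"
  proof (cases "a \<in> I")
    case False
    have "I \<inter> {..b} \<subseteq> I \<inter> {..a} \<or> I \<inter> {..b} \<subseteq> I \<inter> {a..b}"
      using False mem_is_interval_1_I[OF I, of _ _ a] by fastforce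
    thus ?thesis
      by (metis add_increasing add_increasing2 curve_length_mono zero_le)
  qed (simp add: curve_length_subadditive \<open>a \<le> b\<close>)
  hence "ennreal (arclength_upto \<gamma> b) \<le> ennreal (arclength_upto \<gamma> a) + curve_length g (I \<inter> {a..b})"
    using ennreal_arclength_upto[OF rect] by (simp add: \<gamma>)
  moreover have "emeasure (interval_measure (arclength_upto \<gamma>)) {a<..b} = ennreal (arclength_upto \<gamma> b - arclength_upto \<gamma> a)"
    using \<open>a \<le> b\<close> by (intro emeasure_interval_measure_Ioc arclength_upto_mono arclength_upto_continuous_right rect)
  ultimately show ?thesis
    by (simp add: \<gamma> ennreal_minus[symmetric] arclength_upto_nonneg ennreal_minus_le_iff)
qed

lemma sum_curve_length_le:
  assumes "\<And>j. \<tau> j \<le> \<tau> (Suc j)"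
  shows "(\<Sum>j<m. curve_length g (U \<inter> {\<tau> j..\<tau> (Suc j)})) \<le> curve_length g (U \<inter> {..\<tau> m})"
proof (induction m)
  case (Suc m)
  have "(\<Sum>j<Suc m. curve_length g (U \<inter> {\<tau> j..\<tau> (Suc j)}))
      \<le> curve_length g (U \<inter> {..\<tau> m}) + curve_length g (U \<inter> {\<tau> m..\<tau> (Suc m)})"
    using Suc by (simp add: add_right_mono)
  also have "\<dots> = curve_length g (U \<inter> {..\<tau> (Suc m)} \<inter> {..\<tau> m}) + curve_length g (U \<inter> {..\<tau> (Suc m)} \<inter> {\<tau> m..})"
    using assms[of m] by (intro arg_cong2[where f="(+)"] arg_cong[where f="curve_length g"]) auto
  also have "\<dots> \<le> curve_length g (U \<inter> {..\<tau> (Suc m)})" by (rule curve_length_superadditive)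
  finally show ?case .
qed simp

text \<open>
  \<open>U\<close> is exhausted by dyadic cells whose part in the parameter interval lies in \<open>U\<close>;
  Fatou's lemma makes it unnecessary to arrange the exhaustion monotonically.
\<close>

lemma emeasure_arclength_relatively_open:
  assumes rect: "rectifiable \<gamma>" and "open O'" and U: "U = fst \<gamma> \<inter> O'"
  shows "emeasure (interval_measure (arclength_upto \<gamma>)) U \<le> curve_length (snd \<gamma>) U"
proof -
  obtain I g where \<gamma>: "\<gamma> = (I, g)" by (cases \<gamma>)
  have I: "is_interval I" using rect by (auto simp: rectifiable_def is_curve_def \<gamma>)
  define N where "N = interval_measure (arclength_upto \<gamma>)"
  have setsN[measurable_cong]: "sets N = sets borel" by (simp add: N_def)
  \<comment> \<open>Grid of mesh 2^(-n) from -2^n to 2^n, hence 2 * 4^n cells.\<close>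
  define \<tau> where "\<tau> n j = real j / 2 ^ n - 2 ^ n" for n j :: nat
  have \<tau>_mono: "\<tau> n j \<le> \<tau> n (Suc j)" for n j by (simp add: \<tau>_def divide_right_mono)
  \<comment> \<open>The closed cell is tested while the half-open cell is measured: the half-open
    cells are disjoint, and the length bound of \<open>emeasure_arclength_Ioc\<close> refers to the
    closed one.\<close>
  define K where "K n = {j. j < 2 * 4 ^ n \<and> I \<inter> {\<tau> n j..\<tau> n (Suc j)} \<subseteq> U}" for n
  have finK: "finite (K n)" for n by (simp add: K_def)
  define u :: "nat \<Rightarrow> real \<Rightarrow> ennreal" where "u n x = (\<Sum>j\<in>K n. indicator {\<tau> n j<..\<tau> n (Suc j)} x)" for n x
  have [measurable]: "u n \<in> borel_measurable N" for n
    unfolding u_def[abs_def] by measurable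
  have int: "(\<integral>\<^sup>+x. u n x \<partial>N) \<le> curve_length g U" for n
  proof -
    have "(\<integral>\<^sup>+x. u n x \<partial>N) = (\<Sum>j\<in>K n. emeasure N {\<tau> n j<..\<tau> n (Suc j)})"
      unfolding u_def by (simp add: nn_integral_sum)
    also have "\<dots> \<le> (\<Sum>j\<in>K n. curve_length g (U \<inter> {\<tau> n j..\<tau> n (Suc j)}))"
    proof (rule sum_mono)
      fix j assume "j \<in> K n"
      hence "I \<inter> {\<tau> n j..\<tau> n (Suc j)} = U \<inter> {\<tau> n j..\<tau> n (Suc j)}" by (auto simp: K_def U \<gamma>)
      thus "emeasure N {\<tau> n j<..\<tau> n (Suc j)} \<le> curve_length g (U \<inter> {\<tau> n j..\<tau> n (Suc j)})"
        using emeasure_arclength_Ioc[OF rect \<tau>_mono, of n j] by (simp add: N_def \<gamma>)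
    qed
    also have "\<dots> \<le> (\<Sum>j<2 * 4 ^ n. curve_length g (U \<inter> {\<tau> n j..\<tau> n (Suc j)}))"
      by (intro sum_mono2) (auto simp: K_def)
    also have "\<dots> \<le> curve_length g (U \<inter> {..\<tau> n (2 * 4 ^ n)})"
      by (rule sum_curve_length_le) (rule \<tau>_mono)
    also have "\<dots> \<le> curve_length g U" by (intro curve_length_mono) auto
    finally show ?thesis .
  qed
  have cover: "indicator U x \<le> liminf (\<lambda>n. u n x)" for x
  proof (cases "x \<in> U")
    case True
    then obtain \<delta> where \<delta>: "0 < \<delta>" "ball x \<delta> \<subseteq> O'"
      using \<open>open O'\<close> by (auto simp: U open_contains_ball)
    have "eventually (\<lambda>n. \<bar>x\<bar> < 2 ^ n) sequentially" "eventually (\<lambda>n. 1 / 2 ^ n < \<delta>) sequentially"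
      using \<delta>(1) by real_asymp+
    hence "eventually (\<lambda>n. 1 \<le> u n x) sequentially"
    proof eventually_elim
      case (elim n)
      \<comment> \<open>Cells are open on the left, so a grid point x belongs to the cell that ends
        at it: ceiling minus one rather than floor.\<close>
      define j where "j = nat (\<lceil>(x + 2 ^ n) * 2 ^ n\<rceil> - 1)"
      have "0 < (x + 2 ^ n) * 2 ^ n" using elim(1) by (intro mult_pos_pos) auto
      hence j: "real j < (x + 2 ^ n) * 2 ^ n" "(x + 2 ^ n) * 2 ^ n \<le> real j + 1"
        unfolding j_def by linarith+
      have x: "\<tau> n j < x" "x \<le> \<tau> n (Suc j)"
        using j by (auto simp: \<tau>_def field_simps)
      have "(x + 2 ^ n) * 2 ^ n < (2 ^ n + 2 ^ n) * 2 ^ n" using elim(1) by (intro mult_strict_right_mono) auto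
      also have "\<dots> = real (2 * 4 ^ n)" by (simp add: power_mult_distrib[symmetric] distrib_right)
      finally have "real j < real (2 * 4 ^ n)" using j(1) by linarith
      hence "j < 2 * 4 ^ n" by (simp only: of_nat_less_iff)
      moreover have "\<tau> n (Suc j) - \<tau> n j = 1 / 2 ^ n" by (simp add: \<tau>_def add_divide_distrib)
      hence "{\<tau> n j..\<tau> n (Suc j)} \<subseteq> ball x \<delta>"
        using x elim(2) by (auto simp: dist_real_def)
      ultimately have "j \<in> K n" using \<delta>(2) by (auto simp: K_def U \<gamma>)
      hence "indicator {\<tau> n j<..\<tau> n (Suc j)} x \<le> u n x"
        unfolding u_def by (intro member_le_sum finK) auto
      thus ?case using x by simp
    qed
    hence "1 \<le> liminf (\<lambda>n. u n x)" by (rule Liminf_bounded)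
    thus ?thesis using True by simp
  qed simp
  have "I \<in> sets borel" using I by (rule real_interval_borel_measurable)
  hence "U \<in> sets N" using \<open>open O'\<close> by (simp add: setsN U \<gamma>)
  hence "emeasure N U = (\<integral>\<^sup>+x. indicator U x \<partial>N)" by simp
  also have "\<dots> \<le> (\<integral>\<^sup>+x. liminf (\<lambda>n. u n x) \<partial>N)" by (intro nn_integral_mono cover)
  also have "\<dots> \<le> liminf (\<lambda>n. \<integral>\<^sup>+x. u n x \<partial>N)" by (rule nn_integral_liminf) measurable
  also have "\<dots> \<le> liminf (\<lambda>n. curve_length g U)" using int by (intro Liminf_mono) auto
  also have "\<dots> = curve_length g U" by (simp add: Liminf_const)
  finally show ?thesis by (simp add: N_def \<gamma>)
qed

lemma emeasure_arclength_measure: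
  assumes "rectifiable \<gamma>" "V \<in> sets borel"
  shows "emeasure (arclength_measure \<gamma>) V
    = emeasure (interval_measure (arclength_upto \<gamma>)) (fst \<gamma> \<inter> snd \<gamma> -` V)"
proof -
  have I: "fst \<gamma> \<in> sets borel" and "continuous_on (fst \<gamma>) (snd \<gamma>)"
    using assms(1) by (auto simp: rectifiable_def is_curve_def real_interval_borel_measurable)
  hence "snd \<gamma> \<in> borel_measurable (restrict_space borel (fst \<gamma>))"
    by (intro borel_measurable_continuous_on_restrict)
  moreover have "sets (restrict_space (interval_measure (arclength_upto \<gamma>)) (fst \<gamma>)) = sets (restrict_space borel (fst \<gamma>))"
    by (intro sets_restrict_space_cong) simp
  ultimately have "snd \<gamma> \<in> borel_measurable (restrict_space (interval_measure (arclength_upto \<gamma>)) (fst \<gamma>))"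
    by (simp cong: measurable_cong_sets)
  hence "emeasure (arclength_measure \<gamma>) V
    = emeasure (restrict_space (interval_measure (arclength_upto \<gamma>)) (fst \<gamma>)) (snd \<gamma> -` V \<inter> fst \<gamma>)"
    unfolding arclength_measure_def arclength_upto_def[symmetric]
    using assms(2) by (subst emeasure_distr) (auto simp: space_restrict_space)
  also have "\<dots> = emeasure (interval_measure (arclength_upto \<gamma>)) (snd \<gamma> -` V \<inter> fst \<gamma>)"
    using I by (intro emeasure_restrict_space) auto
  finally show ?thesis by (simp add: Int_commute)
qed

text \<open>The preimage of an open set is relatively open in the parameter interval, so the dyadic
  exhaustion applies. For this reason the half-planes are open throughout.\<close>

lemma emeasure_arclength_open_le:
  assumes "rectifiable \<gamma>" "open V"
  shows "emeasure (arclength_measure \<gamma>) V \<le> curve_length (snd \<gamma>) (fst \<gamma> \<inter> snd \<gamma> -` V)"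
proof -
  have "continuous_on (fst \<gamma>) (snd \<gamma>)"
    using assms(1) by (auto simp: rectifiable_def is_curve_def)
  then obtain O' where "open O'" "fst \<gamma> \<inter> snd \<gamma> -` V = fst \<gamma> \<inter> O'"
    using assms(2) unfolding continuous_on_open_invariant by (metis Int_commute)
  thus ?thesis
    using emeasure_arclength_relatively_open[OF assms(1)] assms by (simp add: emeasure_arclength_measure)
qed

section \<open>Convex curves\<close>

text \<open>Quantifying over finite sets A of parameters forces the level sets to be finite, whereas
  \<open>card\<close> of an infinite level set would be 0; it also passes to increasing unions. The
  set E collects the exceptional levels and is a null set.\<close>

definition at_most_twice :: "('a \<Rightarrow> real) \<Rightarrow> 'a set \<Rightarrow> bool" where
  "at_most_twice u I \<longleftrightarrow>
     (\<exists>E. countable E \<and> (\<forall>y A. y \<notin> E \<longrightarrow> finite A \<longrightarrow> A \<subseteq> I \<longrightarrow> (\<forall>t\<in>A. u t = y) \<longrightarrow> card A \<le> 2))"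

text \<open>
  The easy half of Banach's indicatrix theorem.  The points of \<open>ts\<close> need not lie in one interval on
  which \<open>u\<close> stays between \<open>x\<close> and \<open>y\<close>: only the segments between consecutive values are
  counted, and the intermediate value theorem finds preimages anywhere in \<open>I\<close>.
\<close>

lemma polygon_variation_le:
  fixes u :: "real \<Rightarrow> real"
  assumes twice: "at_most_twice u I" and I: "is_interval I" and cont: "continuous_on I u"
    and ts: "sorted ts" "set ts \<subseteq> I" and range: "\<And>t. t \<in> set ts \<Longrightarrow> u t \<in> {x..y}" and "x \<le> y"
  shows "(\<Sum>i<length ts - 1. \<bar>u (ts ! Suc i) - u (ts ! i)\<bar>) \<le> 2 * (y - x)"
proof -
  obtain E where E: "countable E" "\<And>v A. v \<notin> E \<Longrightarrow> finite A \<Longrightarrow> A \<subseteq> I \<Longrightarrow> (\<forall>t\<in>A. u t = v) \<Longrightarrow> card A \<le> 2"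
    using twice unfolding at_most_twice_def by blast
  define n where "n = length ts - 1"
  \<comment> \<open>The interval is open, so a level in it is attained strictly between the two
    vertices. Preimages found on different edges are therefore distinct.\<close>
  define J where "J i = {min (u (ts ! i)) (u (ts ! Suc i))<..<max (u (ts ! i)) (u (ts ! Suc i))}" for i
  have le: "ts ! i \<le> ts ! j" if "i \<le> j" "j \<le> n" "0 < n" for i j
    using that by (intro sorted_nth_mono ts(1)) (auto simp: n_def)
  have mem: "ts ! i \<in> set ts" if "i \<le> n" "0 < n" for i
    using that by (intro nth_mem) (auto simp: n_def)
  have count: "(\<Sum>i<n. indicator (J i) v :: ennreal) \<le> 2 * indicator {x..y} v" if "v \<notin> E" for v
  proof -
    define K where "K = {i. i < n \<and> v \<in> J i}"
    have "\<exists>\<tau>. ts ! i < \<tau> \<and> \<tau> < ts ! Suc i \<and> \<tau> \<in> I \<and> u \<tau> = v" if "i \<in> K" for i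
    proof -
      have i: "i < n" "v \<in> J i" using that by (auto simp: K_def)
      let ?a = "ts ! i" and ?b = "ts ! Suc i"
      have ab: "?a \<le> ?b" "?a \<in> I" "?b \<in> I" using i le[of i "Suc i"] mem[of i] mem[of "Suc i"] ts(2) by auto
      have sub: "{?a..?b} \<subseteq> I" using mem_is_interval_1_I[OF I ab(2,3)] by auto
      have "\<exists>\<tau>. ?a \<le> \<tau> \<and> \<tau> \<le> ?b \<and> u \<tau> = v"
      proof (cases "u ?a \<le> u ?b")
        case True
        thus ?thesis using i ab by (intro IVT' continuous_on_subset[OF cont sub]) (auto simp: J_def)
      next
        case False
        thus ?thesis using i ab by (intro IVT2' continuous_on_subset[OF cont sub]) (auto simp: J_def)
      qed
      then obtain \<tau> where \<tau>: "?a \<le> \<tau>" "\<tau> \<le> ?b" "u \<tau> = v" by blast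
      moreover have "\<tau> \<noteq> ?a" "\<tau> \<noteq> ?b" using \<tau>(3) i(2) by (auto simp: J_def min_def max_def split: if_splits)
      ultimately show ?thesis using sub by (intro exI[of _ \<tau>]) auto
    qed
    then obtain \<tau> where \<tau>: "\<And>i. i \<in> K \<Longrightarrow> ts ! i < \<tau> i \<and> \<tau> i < ts ! Suc i \<and> \<tau> i \<in> I \<and> u (\<tau> i) = v"
      by metis
    have lt: "\<tau> i < \<tau> j" if "i \<in> K" "j \<in> K" "i < j" for i j
      using \<tau>[OF that(1)] \<tau>[OF that(2)] le[of "Suc i" j] that by (auto simp: K_def)
    have "inj_on \<tau> K" by (rule inj_onI) (metis lt linorder_neqE_nat less_irrefl)
    moreover have "finite K" by (simp add: K_def)
    moreover have "card (\<tau> ` K) \<le> 2"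
      using \<tau> \<open>finite K\<close> by (intro E(2)[OF \<open>v \<notin> E\<close>]) auto
    ultimately have card: "card K \<le> 2" by (simp add: card_image)
    have "(\<Sum>i<n. indicator (J i) v :: ennreal) = (\<Sum>i\<in>K. 1)"
      unfolding K_def by (intro sum.mono_neutral_cong_right) (auto simp: indicator_def)
    also have "\<dots> = of_nat (card K)" by simp
    finally have sum: "(\<Sum>i<n. indicator (J i) v :: ennreal) = of_nat (card K)" .
    show ?thesis
    proof (cases "K = {}")
      case False
      then obtain i where i: "i < n" "v \<in> J i" by (auto simp: K_def)
      have "v \<in> {x..y}"
        using i range[OF mem, of i] range[OF mem, of "Suc i"] by (auto simp: J_def min_def max_def split: if_splits)
      moreover have "(of_nat (card K) :: ennreal) \<le> of_nat 2" using card by (rule of_nat_mono)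
      ultimately show ?thesis by (simp add: sum)
    qed (simp add: sum)
  qed
  \<comment> \<open>The variation is the integral over v of the number of edges whose value interval
    contains v. For almost every v this number is at most 2, and it is 0 outside
    \<open>{x..y}\<close>.\<close>
  have "emeasure lborel (J i) = ennreal \<bar>u (ts ! Suc i) - u (ts ! i)\<bar>" for i
    unfolding J_def by (subst emeasure_lborel_Ioo) (auto simp: min_def max_def)
  hence "ennreal (\<Sum>i<n. \<bar>u (ts ! Suc i) - u (ts ! i)\<bar>) = (\<Sum>i<n. emeasure lborel (J i))"
    by simp
  also have "\<dots> = (\<integral>\<^sup>+v. (\<Sum>i<n. indicator (J i) v) \<partial>lborel)"
    by (subst nn_integral_sum) (auto simp: J_def)
  also have "\<dots> \<le> (\<integral>\<^sup>+v. 2 * indicator {x..y} v \<partial>lborel)"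
  proof (rule nn_integral_mono_AE)
    have "AE v in lborel. v \<notin> E"
      using E(1) by (intro AE_not_in countable_imp_null_set_lborel)
    thus "AE v in lborel. (\<Sum>i<n. indicator (J i) v :: ennreal) \<le> 2 * indicator {x..y} v"
      by eventually_elim (rule count)
  qed
  also have "\<dots> = 2 * ennreal (y - x)" using \<open>x \<le> y\<close> by (simp add: nn_integral_cmult)
  also have "\<dots> = ennreal (2 * (y - x))" using \<open>x \<le> y\<close> by (simp only: ennreal_mult'' ennreal_numeral)
  finally show ?thesis using \<open>x \<le> y\<close> by (simp add: n_def)
qed

text \<open>An edge is no longer than the sum of its coordinate increments, and each coordinate has
  variation at most twice the side of the box. Preimages are counted in the whole interval I, while
  the box needs to contain only the piece S.\<close>

lemma curve_length_box_le:
  fixes g :: "real \<Rightarrow> complex"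
  assumes "at_most_twice (\<lambda>t. Re (g t)) I" "at_most_twice (\<lambda>t. Im (g t)) I"
    and I: "is_interval I" and cont: "continuous_on I g"
    and "S \<subseteq> I" and box: "g ` S \<subseteq> cbox (Complex x0 y0) (Complex x1 y1)" and "x0 \<le> x1" "y0 \<le> y1"
  shows "curve_length g S \<le> ennreal (2 * (x1 - x0) + 2 * (y1 - y0))"
proof (rule curve_length_leI, rule ennreal_leI)
  fix ts assume ts: "sorted ts" "set ts \<subseteq> S"
  have "polygon_length g ts \<le> (\<Sum>i<length ts - 1. \<bar>Re (g (ts ! Suc i)) - Re (g (ts ! i))\<bar> + \<bar>Im (g (ts ! Suc i)) - Im (g (ts ! i))\<bar>)"
    unfolding polygon_length_sum
  proof (rule sum_mono)
    fix i
    show "dist (g (ts ! i)) (g (ts ! Suc i)) \<le> \<bar>Re (g (ts ! Suc i)) - Re (g (ts ! i))\<bar> + \<bar>Im (g (ts ! Suc i)) - Im (g (ts ! i))\<bar>"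
      using cmod_le[of "g (ts ! Suc i) - g (ts ! i)"] by (simp add: dist_norm norm_minus_commute[of "g (ts ! i)"])
  qed
  also have "\<dots> \<le> 2 * (x1 - x0) + 2 * (y1 - y0)"
  proof -
    have "set ts \<subseteq> I" using ts(2) assms(5) by blast
    moreover have "Re (g t) \<in> {x0..x1}" "Im (g t) \<in> {y0..y1}" if "t \<in> set ts" for t
      using box ts(2) that by (auto simp: in_cbox_complex_iff image_subset_iff)
    ultimately show ?thesis
      unfolding sum.distrib using assms(1,2,7,8)
      by (intro add_mono polygon_variation_le[OF _ I _ ts(1)] continuous_intros cont) auto
  qed
  finally show "polygon_length g ts \<le> 2 * (x1 - x0) + 2 * (y1 - y0)" .
qed

section \<open>Lines and the frontier of a plane convex set\<close>

text \<open>The open segment from an interior point to a point of the closure is interior, so a ray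
  from \<open>c\<close> cannot meet the frontier twice.\<close>

lemma frontier_collinear_interior:
  fixes K :: "'a::euclidean_space set"
  assumes "convex K" and c: "c \<in> interior K" and p: "p \<in> frontier K" "c + r *\<^sub>R (p - c) \<in> frontier K" and "0 < r"
  shows "r = 1"
proof -
  have open_seg: "open_segment c q \<subseteq> interior K" if "q \<in> frontier K" for q
    using that assms(1) c by (intro in_interior_closure_convex_segment) (auto simp: frontier_def)
  have ni: "q \<notin> interior K" if "q \<in> frontier K" for q using that by (auto simp: frontier_def)
  have "p \<noteq> c" using ni[OF p(1)] c by auto
  show ?thesis
  proof (rule ccontr)
    assume "r \<noteq> 1"
    show False
    proof (cases "r < 1")
      case True
      have "c + r *\<^sub>R (p - c) \<in> open_segment c p"
        using True \<open>0 < r\<close> \<open>p \<noteq> c\<close>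
        by (auto simp: in_segment algebra_simps intro!: exI[of _ r])
      thus False using open_seg[OF p(1)] ni[OF p(2)] by blast
    next
      case False
      define q where "q = c + r *\<^sub>R (p - c)"
      have "1 < r" using False \<open>r \<noteq> 1\<close> by simp
      have "p = c + (1 / r) *\<^sub>R (q - c)" using \<open>1 < r\<close> by (simp add: q_def)
      moreover have "q \<noteq> c" using \<open>1 < r\<close> \<open>p \<noteq> c\<close> by (simp add: q_def)
      ultimately have "p \<in> open_segment c q"
        using \<open>1 < r\<close> by (auto simp: in_segment algebra_simps intro!: exI[of _ "1 / r"])
      thus False using open_seg[OF p(2)] ni[OF p(1)] by (auto simp: q_def)
    qed
  qed
qed

lemma perp_parallel:
  fixes w d e :: complex
  assumes "w \<bullet> d = 0" "w \<bullet> e = 0" "w \<noteq> 0" "d \<noteq> 0"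
  shows "\<exists>r. e = r *\<^sub>R d"
proof -
  have *: "Re w * Re d + Im w * Im d = 0" "Re w * Re e + Im w * Im e = 0"
    using assms(1,2) by (simp_all add: inner_complex_def)
  have cross: "Re d * Im e = Im d * Re e"
  proof -
    \<comment> \<open>Cramer's rule: a nonzero w orthogonal to both d and e forces their determinant
      to vanish.\<close>
    have "Re w * (Re d * Im e - Im d * Re e) = (Re w * Re d + Im w * Im d) * Im e - Im d * (Re w * Re e + Im w * Im e)"
      "Im w * (Re d * Im e - Im d * Re e) = Re d * (Re w * Re e + Im w * Im e) - Re e * (Re w * Re d + Im w * Im d)"
      by (simp_all add: algebra_simps)
    hence "Re w * (Re d * Im e - Im d * Re e) = 0" "Im w * (Re d * Im e - Im d * Re e) = 0"
      unfolding * by simp_all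
    thus ?thesis using \<open>w \<noteq> 0\<close> by (auto simp: complex_eq_iff)
  qed
  show ?thesis
  proof (cases "Re d = 0")
    case True
    hence "Im d \<noteq> 0" using \<open>d \<noteq> 0\<close> by (simp add: complex_eq_iff)
    thus ?thesis using True cross by (intro exI[of _ "Im e / Im d"]) (simp add: complex_eq_iff)
  next
    case False
    thus ?thesis using cross by (intro exI[of _ "Re e / Re d"]) (simp add: complex_eq_iff field_simps)
  qed
qed

text \<open>The interior point \<open>c\<close> divides the line into two rays, and each of them
  meets the frontier at most once.\<close>

lemma card_frontier_line_le:
  fixes w :: complex
  assumes "convex K" "w \<noteq> 0" and c: "c \<in> interior K" "w \<bullet> c = y"
    and A: "finite A" "A \<subseteq> frontier K" "\<And>z. z \<in> A \<Longrightarrow> w \<bullet> z = y"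
  shows "card A \<le> 2"
proof (cases "A = {}")
  case False
  then obtain p where p: "p \<in> A" by auto
  have "p \<noteq> c" using p A(2) c(1) by (auto simp: frontier_def)
  have "\<exists>r. z = c + r *\<^sub>R (p - c)" if "z \<in> A" for z
  proof -
    have "w \<bullet> (p - c) = 0" "w \<bullet> (z - c) = 0" using A(3) p that c(2) by (simp_all add: inner_diff_right)
    then obtain r where "z - c = r *\<^sub>R (p - c)" using perp_parallel assms(2) \<open>p \<noteq> c\<close> by (metis right_minus_eq)
    thus ?thesis by (intro exI[of _ r]) (simp add: algebra_simps)
  qed
  then obtain r where r: "\<And>z. z \<in> A \<Longrightarrow> z = c + r z *\<^sub>R (p - c)" by metis
  have r0: "r z \<noteq> 0" if "z \<in> A" for z
  proof
    assume "r z = 0"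
    hence "z = c" using r[OF that] by simp
    thus False using that A(2) c(1) by (auto simp: frontier_def)
  qed
  have eq: "z = z'" if "z \<in> A" "z' \<in> A" "r z * r z' > 0" for z z'
  proof -
    have "c + (r z' / r z) *\<^sub>R (z - c) = c + (r z' / r z * r z) *\<^sub>R (p - c)"
      by (subst (2) r[OF that(1)]) simp
    also have "\<dots> = z'" using r0[OF that(1)] r[OF that(2)] by simp
    finally have z': "z' = c + (r z' / r z) *\<^sub>R (z - c)" ..
    have "r z' / r z = 1"
    proof (rule frontier_collinear_interior[OF \<open>convex K\<close> c(1)])
      show "z \<in> frontier K" using that A(2) by auto
      show "c + (r z' / r z) *\<^sub>R (z - c) \<in> frontier K" using z' that A(2) by auto
      show "0 < r z' / r z" using that(3) by (auto simp: zero_less_mult_iff zero_less_divide_iff)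
    qed
    thus ?thesis using z' by simp
  qed
  have "card {z\<in>A. 0 < r z} \<le> 1" "card {z\<in>A. r z < 0} \<le> 1"
    using A(1) eq by (auto simp: card_le_Suc0_iff_eq intro!: mult_pos_pos mult_neg_neg)
  moreover have "A = {z\<in>A. 0 < r z} \<union> {z\<in>A. r z < 0}" using r0 by (auto simp: neq_iff)
  ultimately show ?thesis using card_Un_le[of "{z\<in>A. 0 < r z}" "{z\<in>A. r z < 0}"] by simp
qed simp

text \<open>For J the set of levels of the interior of a convex set, the endpoints not in J belong
  to supporting lines. Such a line may contain a whole side, so these levels, at most two, have to
  be excluded.\<close>

lemma countable_closure_diff_interval:
  assumes "is_interval (J::real set)"
  shows "countable (closure J - J)"
proof -
  have "closure J - J \<subseteq> {Inf J, Sup J}"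
  proof
    fix y assume y: "y \<in> closure J - J"
    hence "J \<noteq> {}" by auto
    have "(\<forall>x\<in>J. x < y) \<or> (\<forall>x\<in>J. y < x)"
      using y mem_is_interval_1_I[OF assms, of _ _ y] by (metis DiffD2 linorder_not_le nle_le)
    thus "y \<in> {Inf J, Sup J}"
    proof
      assume *: "\<forall>x\<in>J. x < y"
      have "Sup J = y"
      proof (rule cSup_eq_non_empty[OF \<open>J \<noteq> {}\<close>])
        fix b assume "\<And>x. x \<in> J \<Longrightarrow> x \<le> b"
        hence "closure J \<subseteq> {..b}" by (intro closure_minimal) auto
        thus "y \<le> b" using y by auto
      qed (use * in auto)
      thus ?thesis by simp
    next
      assume *: "\<forall>x\<in>J. y < x"
      have "Inf J = y"
      proof (rule cInf_eq_non_empty[OF \<open>J \<noteq> {}\<close>])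
        fix b assume "\<And>x. x \<in> J \<Longrightarrow> b \<le> x"
        hence "closure J \<subseteq> {b..}" by (intro closure_minimal) auto
        thus "b \<le> y" using y by auto
      qed (use * in auto)
      thus ?thesis by simp
    qed
  qed
  thus ?thesis by (rule countable_subset) simp
qed

text \<open>If K has interior, a level attained in the interior meets the frontier at most twice,
  and a simple path visits each point once in \<open>{0..<1}\<close>. If not, K lies on a line:
  either w is constant on it and one level is exceptional, or each level singles out one point,
  which is visited at most twice by definition.\<close>

lemma convex_closed_path_at_most_twice:
  fixes w :: complex
  assumes q: "convex_closed_path q" and "w \<noteq> 0"
  shows "at_most_twice (\<lambda>t. w \<bullet> q t) {0..<1}"
proof -
  obtain K where K: "convex K" "path_image q = frontier K"
    and simp: "interior K \<noteq> {} \<Longrightarrow> simple_path q"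
    and degen: "interior K = {} \<Longrightarrow> finite {t\<in>{0..<1}. q t = z} \<and> card {t\<in>{0..<1}. q t = z} \<le> 2" for z
    using q unfolding convex_closed_path_def by (auto split: if_splits)
  have img: "q t \<in> frontier K" if "t \<in> {0..<1}" for t
    using that K(2) by (auto simp: path_image_def)
  show ?thesis
  proof (cases "interior K = {}")
    case False
    define J where "J = (\<lambda>z. w \<bullet> z) ` interior K"
    have "is_interval J"
      unfolding J_def is_interval_convex_1
      by (intro convex_linear_image convex_interior K bounded_linear.linear[OF bounded_linear_inner_right])
    have "card A \<le> 2" if y: "y \<notin> closure J - J" and A: "finite A" "A \<subseteq> {0..<1}" "\<forall>t\<in>A. w \<bullet> q t = y" for y A
    proof (cases "A = {}")
      case nonempty: False
      then obtain t where t: "t \<in> A" by auto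
      \<comment> \<open>A frontier point is a limit of interior points, so its level lies in
        \<open>closure J\<close>; not being exceptional, it lies in J.\<close>
      have "q t \<in> closure (interior K)"
        using img[of t] t A(2) convex_closure_interior[OF K(1) False] by (auto simp: frontier_def)
      hence "w \<bullet> q t \<in> closure J"
        using image_closure_subset[of "interior K" "\<lambda>z. w \<bullet> z" "closure J"]
          closure_subset[of J] continuous_on_inner[OF continuous_on_const[of _ w] continuous_on_id[of "closure (interior K)"]]
        by (auto simp: J_def)
      hence "y \<in> J" using y A(3) t by auto
      then obtain c where c: "c \<in> interior K" "w \<bullet> c = y" by (auto simp: J_def)
      have "inj_on q A"
        using simp[OF False] A(2) unfolding simple_path_def loop_free_def by (intro inj_onI) fastforce
      hence "card A = card (q ` A)" by (simp add: card_image)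
      also have "\<dots> \<le> 2"
        using A img by (intro card_frontier_line_le[OF K(1) \<open>w \<noteq> 0\<close> c]) auto
      finally show ?thesis .
    qed simp
    thus ?thesis
      unfolding at_most_twice_def
      using countable_closure_diff_interval[OF \<open>is_interval J\<close>] by (intro exI[of _ "closure J - J"]) blast
  next
    case True
    obtain a b where a: "a \<noteq> 0" "K \<subseteq> {x. a \<bullet> x = b}"
      using empty_interior_subset_hyperplane[OF K(1) True] by blast
    have "closure K \<subseteq> {x. a \<bullet> x = b}" using a(2) by (intro closure_minimal closed_hyperplane)
    hence line: "a \<bullet> q t = b" if "t \<in> {0..<1}" for t
      using img[OF that] by (auto simp: frontier_def)
    show ?thesis
    proof (cases "\<exists>k. w = k *\<^sub>R a")
      case True
      then obtain k where "w = k *\<^sub>R a" ..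
      hence const: "w \<bullet> q t = k * b" if "t \<in> {0..<1}" for t using line[OF that] by simp
      show ?thesis
        unfolding at_most_twice_def
      proof (intro exI[of _ "{k * b}"] conjI allI impI)
        fix y A
        assume "y \<notin> {k * b}" "A \<subseteq> {0..<1}" "\<forall>t\<in>A. w \<bullet> q t = y"
        hence "t \<notin> A" for t using const[of t] by (metis insertI1 subsetD)
        hence "A = {}" by (intro equals0I) auto
        thus "card A \<le> 2" by simp
      qed simp
    next
      case nonpar: False
      have "card A \<le> 2" if A: "A \<subseteq> {0..<1}" "\<forall>t\<in>A. w \<bullet> q t = y" for y A
      proof (cases "A = {}")
        case False
        then obtain t where t: "t \<in> A" by auto
        have "q s = q t" if "s \<in> A" for s
        proof (rule ccontr)
          assume "q s \<noteq> q t"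
          have "a \<bullet> q s = a \<bullet> q t" "w \<bullet> q s = w \<bullet> q t"
            using line[OF subsetD[OF A(1) that]] line[OF subsetD[OF A(1) t]] bspec[OF A(2) that] bspec[OF A(2) t] by simp_all
          hence "(q s - q t) \<bullet> a = 0" "(q s - q t) \<bullet> w = 0"
            by (simp_all add: inner_diff_right inner_commute[of "q s - q t"])
          thus False using perp_parallel[of "q s - q t" a w] \<open>q s \<noteq> q t\<close> a(1) nonpar by auto
        qed
        hence "A \<subseteq> {s\<in>{0..<1}. q s = q t}" using A by auto
        thus ?thesis using degen[OF True, of "q t"] card_mono order_trans by blast
      qed simp
      thus ?thesis unfolding at_most_twice_def by (intro exI[of _ "{}"] conjI allI impI) simp_all
    qed
  qed
qed

lemma at_most_twice_vimage:
  assumes "at_most_twice u B" "inj_on f I" "f ` I \<subseteq> B" "\<And>t. t \<in> I \<Longrightarrow> v t = u (f t)"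
  shows "at_most_twice v I"
proof -
  obtain E where E: "countable E" "\<And>y A. y \<notin> E \<Longrightarrow> finite A \<Longrightarrow> A \<subseteq> B \<Longrightarrow> (\<forall>t\<in>A. u t = y) \<Longrightarrow> card A \<le> 2"
    using assms(1) unfolding at_most_twice_def by blast
  have "card A \<le> 2" if "y \<notin> E" "finite A" "A \<subseteq> I" "\<forall>t\<in>A. v t = y" for y A
  proof -
    have "card A = card (f ` A)"
      using inj_on_subset[OF assms(2) that(3)] by (simp add: card_image)
    also have "\<dots> \<le> 2" using that assms(3,4) by (intro E(2)[OF that(1)]) (auto simp: subset_iff image_subset_iff)
    finally show ?thesis .
  qed
  thus ?thesis using E(1) unfolding at_most_twice_def by blast
qed

text \<open>One more parameter costs one more exceptional level, \<open>u t\<close>.\<close>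

lemma at_most_twice_insert:
  assumes "at_most_twice u I"
  shows "at_most_twice u (insert t I)"
proof -
  obtain E where E: "countable E" "\<And>y A. y \<notin> E \<Longrightarrow> finite A \<Longrightarrow> A \<subseteq> I \<Longrightarrow> (\<forall>t\<in>A. u t = y) \<Longrightarrow> card A \<le> 2"
    using assms unfolding at_most_twice_def by blast
  show ?thesis unfolding at_most_twice_def
  proof (intro exI[of _ "insert (u t) E"] conjI allI impI)
    fix y A assume A: "y \<notin> insert (u t) E" "finite A" "A \<subseteq> insert t I" "\<forall>t\<in>A. u t = y"
    hence "A \<subseteq> I" by auto
    thus "card A \<le> 2" using A by (intro E(2)) auto
  qed (use E(1) in auto)
qed

text \<open>A finite set of parameters already lies in a single member of the sequence, and the
  countably many exceptional sets are united.\<close>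

lemma at_most_twice_incseq:
  assumes tw: "\<And>k::nat. at_most_twice u (S k)" and inc: "\<And>k. S k \<subseteq> S (Suc k)"
  shows "at_most_twice u (\<Union>k. S k)"
proof -
  obtain E where E: "\<And>k. countable (E k)"
    "\<And>k y A. y \<notin> E k \<Longrightarrow> finite A \<Longrightarrow> A \<subseteq> S k \<Longrightarrow> (\<forall>t\<in>A. u t = y) \<Longrightarrow> card A \<le> 2"
    using tw unfolding at_most_twice_def by metis
  have mono: "S i \<subseteq> S j" if "i \<le> j" for i j using that inc by (rule lift_Suc_mono_le[rotated])
  show ?thesis unfolding at_most_twice_def
  proof (intro exI[of _ "\<Union>k. E k"] conjI allI impI)
    fix y A assume A: "y \<notin> (\<Union>k. E k)" "finite A" "A \<subseteq> (\<Union>k. S k)" "\<forall>t\<in>A. u t = y"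
    obtain n where n: "\<And>t. t \<in> A \<Longrightarrow> t \<in> S (n t)" using A(3) by (metis UN_iff subsetD)
    have "A \<subseteq> S (Max (n ` A))"
      using n mono[OF Max_ge[of "n ` A"]] A(2) by blast
    thus "card A \<le> 2" using A by (intro E(2)) auto
  qed (use E(1) in auto)
qed

lemma convex_on_segment_at_most_twice:
  fixes w :: complex
  assumes g: "convex_on_segment g s t" and "w \<noteq> 0" "s < t"
  shows "at_most_twice (\<lambda>x. w \<bullet> g x) {s..t}"
proof -
  have lin: "linepath s t ((x - s) / (t - s)) = x" for x
  proof -
    have "linepath s t u = s + u * (t - s)" for u
      by (simp add: linepath_def algebra_simps)
    thus ?thesis using \<open>s < t\<close> by simp
  qed
  have "at_most_twice (\<lambda>x. w \<bullet> g x) {s..<t}"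
  proof (cases "g s = g t")
    case True
    hence "convex_closed_path (g \<circ> linepath s t)"
      using g by (simp add: convex_on_segment_def)
    hence "at_most_twice (\<lambda>x. w \<bullet> (g \<circ> linepath s t) x) {0..<1}"
      using \<open>w \<noteq> 0\<close> by (rule convex_closed_path_at_most_twice)
    thus ?thesis
      by (rule at_most_twice_vimage[where f = "\<lambda>x. (x - s) / (t - s)"])
         (use \<open>s < t\<close> in \<open>auto simp: inj_on_def lin field_simps\<close>)
  next
    case False
    hence "convex_closed_path ((g \<circ> linepath s t) +++ linepath (g t) (g s))"
      using g by (simp add: convex_on_segment_def)
    hence "at_most_twice (\<lambda>x. w \<bullet> ((g \<circ> linepath s t) +++ linepath (g t) (g s)) x) {0..<1}"
      using \<open>w \<noteq> 0\<close> by (rule convex_closed_path_at_most_twice)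
    thus ?thesis
    \<comment> \<open>The closing segment occupies the second half of the joined path, so the curve
      is found on parameters up to 1/2.\<close>
    proof (rule at_most_twice_vimage[where f = "\<lambda>x. (x - s) / (t - s) / 2"])
      have join: "w \<bullet> g (linepath s t u) = w \<bullet> ((g \<circ> linepath s t) +++ linepath (g t) (g s)) (u / 2)" if "u \<le> 1" for u
        using that by (simp add: joinpaths_def)
      fix x assume "x \<in> {s..<t}"
      hence "(x - s) / (t - s) \<le> 1" by simp
      thus "w \<bullet> g x = w \<bullet> ((g \<circ> linepath s t) +++ linepath (g t) (g s)) ((x - s) / (t - s) / 2)"
        using join lin by metis
    qed (use \<open>s < t\<close> in \<open>auto simp: inj_on_def divide_le_eq divide_less_eq\<close>)
  qed
  \<comment> \<open>For a closed curve t corresponds to the parameter 1, which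
    \<open>{0..<1}\<close> omits.\<close>
  hence "at_most_twice (\<lambda>x. w \<bullet> g x) (insert t {s..<t})" by (rule at_most_twice_insert)
  moreover have "insert t {s..<t} = {s..t}" using \<open>s < t\<close> by auto
  ultimately show ?thesis by simp
qed

lemma convex_curve_at_most_twice:
  fixes w :: complex
  assumes "convex_curve \<gamma>" "w \<noteq> 0"
  shows "at_most_twice (\<lambda>x. w \<bullet> snd \<gamma> x) (fst \<gamma>)"
proof (cases "compact (fst \<gamma>)")
  case True
  thus ?thesis
    using assms convex_on_segment_at_most_twice unfolding convex_curve_def by auto
next
  case False
  then obtain s t :: "nat \<Rightarrow> real" where st: "\<And>k. s k < t k" "\<And>k. {s k..t k} \<subseteq> {s (Suc k)..t (Suc k)}"
    "(\<Union>k. {s k..t k}) = fst \<gamma>" "\<And>k. convex_on_segment (snd \<gamma>) (s k) (t k)"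
    using assms(1) unfolding convex_curve_def by auto
  show ?thesis
    unfolding st(3)[symmetric]
    by (intro at_most_twice_incseq convex_on_segment_at_most_twice st(1,2,4) \<open>w \<noteq> 0\<close>)
qed

lemma convex_curve_length_box_le:
  assumes "convex_curve \<gamma>" and "S \<subseteq> fst \<gamma>" "snd \<gamma> ` S \<subseteq> cbox (Complex x0 y0) (Complex x1 y1)"
    and "x0 \<le> x1" "y0 \<le> y1"
  shows "curve_length (snd \<gamma>) S \<le> ennreal (2 * (x1 - x0) + 2 * (y1 - y0))"
proof (rule curve_length_box_le[OF _ _ _ _ assms(2-)])
  show "at_most_twice (\<lambda>t. Re (snd \<gamma> t)) (fst \<gamma>)"
    using convex_curve_at_most_twice[OF assms(1), of 1] by (simp add: inner_complex_def)
  show "at_most_twice (\<lambda>t. Im (snd \<gamma> t)) (fst \<gamma>)"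
    using convex_curve_at_most_twice[OF assms(1), of \<i>] by (simp add: inner_complex_def)
qed (use assms(1) in \<open>auto simp: convex_curve_def is_curve_def\<close>)

section \<open>Half-plane bounds for boxed curves\<close>

lemma sets_arclength_measure: "sets (arclength_measure \<gamma>) = sets borel"
  by (simp add: arclength_measure_def)

lemma sets_compound_arclength_measure: "sets (compound_arclength_measure \<gamma>) = sets borel"
  unfolding compound_arclength_measure_def
  by (simp add: sets.sigma_sets_eq[of borel, simplified] sets.space_closed[of borel, simplified])

lemma emeasure_compound_arclength_measure:
  assumes "A \<in> sets borel"
  shows "emeasure (compound_arclength_measure \<gamma>) A = (\<Sum>n. emeasure (arclength_measure (\<gamma> (Suc n))) A)"
proof (rule emeasure_measure_of[OF compound_arclength_measure_def])
  show "countably_additive (sets (compound_arclength_measure \<gamma>))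
      (\<lambda>A. \<Sum>n. emeasure (arclength_measure (\<gamma> (Suc n))) A)"
  proof (rule countably_additiveI)
    fix B :: "nat \<Rightarrow> complex set"
    assume B: "range B \<subseteq> sets (compound_arclength_measure \<gamma>)" "disjoint_family B"
    have "(\<Sum>i. \<Sum>n. emeasure (arclength_measure (\<gamma> (Suc n))) (B i))
        = (\<Sum>n. \<Sum>i. emeasure (arclength_measure (\<gamma> (Suc n))) (B i))"
      \<comment> \<open>Exchanging two series of nonnegative terms is monotone convergence for the
        counting measure.\<close>
      using nn_integral_suminf[of "\<lambda>i n. emeasure (arclength_measure (\<gamma> (Suc n))) (B i)" "count_space UNIV"]
      by (simp add: nn_integral_count_space_nat)
    also have "\<dots> = (\<Sum>n. emeasure (arclength_measure (\<gamma> (Suc n))) (\<Union>i. B i))"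
      using B by (intro suminf_cong suminf_emeasure)
        (auto simp: sets_arclength_measure sets_compound_arclength_measure)
    finally show "(\<Sum>i. \<Sum>n. emeasure (arclength_measure (\<gamma> (Suc n))) (B i))
        = (\<Sum>n. emeasure (arclength_measure (\<gamma> (Suc n))) (\<Union>i. B i))" .
  qed
qed (use assms in \<open>auto simp: positive_def sets_compound_arclength_measure\<close>)

lemma sector_bounds:
  assumes "0 \<le> Arg z" "Arg z \<le> \<alpha>" "\<alpha> < pi / 2"
  shows "0 \<le> Re z" "0 \<le> Im z" "Im z \<le> Re z * tan \<alpha>"
proof -
  have z: "Re z = cmod z * cos (Arg z)" "Im z = cmod z * sin (Arg z)"
    using rcis_cmod_Arg[of z] by (metis Re_rcis, metis Im_rcis)
  have "0 < cos \<alpha>" using assms by (intro cos_gt_zero_pi) auto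
  have "0 \<le> cos (Arg z)" using assms by (intro cos_ge_zero) auto
  thus "0 \<le> Re z" by (simp add: z)
  have "0 \<le> sin (Arg z)" using assms by (intro sin_ge_zero) auto
  thus "0 \<le> Im z" by (simp add: z)
  \<comment> \<open>The addition formula turns this into tan (Arg z) \<le> tan \<alpha> without
    dividing by cos (Arg z).\<close>
  have "0 \<le> sin (\<alpha> - Arg z)" using assms by (intro sin_ge_zero) auto
  hence "sin (Arg z) * cos \<alpha> \<le> cos (Arg z) * sin \<alpha>" by (simp add: sin_diff mult.commute)
  hence "sin (Arg z) \<le> cos (Arg z) * tan \<alpha>" using \<open>0 < cos \<alpha>\<close> by (simp add: tan_def field_simps)
  thus "Im z \<le> Re z * tan \<alpha>" by (simp add: z mult.assoc mult_left_mono)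
qed

section \<open>Total perimeter of the boxes to the left of a vertical line\<close>

text \<open>A difference with shift \<nu> is a sum of \<nu> differences with shift 1, each of which
  telescopes to at most X. The factor \<nu> cancels the averaging in the condition on the
  heights.\<close>

lemma sum_shift_le:
  fixes A :: "nat \<Rightarrow> real"
  assumes "\<And>i. 0 \<le> A i" "\<And>i. A i \<le> X"
  shows "(\<Sum>i<m. A (i + \<nu>) - A i) \<le> real \<nu> * X"
proof (induction \<nu>)
  case (Suc \<nu>)
  have "(\<Sum>i<m. A (i + Suc \<nu>) - A i) = (\<Sum>i<m. A (i + \<nu>) - A i) + (\<Sum>i<m. A (Suc i + \<nu>) - A (i + \<nu>))"
    by (simp add: sum.distrib[symmetric])
  also have "(\<Sum>i<m. A (Suc i + \<nu>) - A (i + \<nu>)) = A (m + \<nu>) - A (0 + \<nu>)"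
    by (rule sum_lessThan_telescope)
  also have "\<dots> \<le> X" using assms(1)[of "0 + \<nu>"] assms(2)[of "m + \<nu>"] by linarith
  finally show ?case using Suc by (simp add: distrib_right)
qed simp

text \<open>
  Clipping the abscissae to \<open>[0, X]\<close> makes both telescoping sums bounded.  The height of a box is
  controlled by \<open>a\<close> unless it is the first one, whose left edge may be far to the left of 0, or
  one of the last \<open>\<nu>\<close>, where \<open>a (n + \<nu>)\<close> may exceed \<open>X\<close>; there the sector gives the bound \<open>T\<close>.
\<close>

lemma sum_box_perimeters_le:
  fixes a b :: "nat \<Rightarrow> real"
  assumes "0 < c" "0 < \<nu>" "0 \<le> T" "0 < X" and mono: "\<And>i. a i \<le> a (Suc i)"
    and nonneg: "\<And>i. 0 < i \<Longrightarrow> 0 \<le> a i" and le: "\<And>i. i < m \<Longrightarrow> a i < X"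
    and b: "\<And>i. c * b i \<le> (a (i + \<nu>) - a i) / real \<nu>"
  defines "A \<equiv> \<lambda>i. max 0 (min X (a i))"
  shows "(\<Sum>i<m. 2 * (A (Suc i) - A i) + 2 * min (b i) T) \<le> 2 * X + 2 * (X / c) + 2 * (real \<nu> + 1) * T"
proof -
  have A: "0 \<le> A i" "A i \<le> X" for i using \<open>0 < X\<close> by (auto simp: A_def)
  have a_mono: "a i \<le> a j" if "i \<le> j" for i j using that mono by (rule lift_Suc_mono_le[rotated])
  have A_mono: "A i \<le> A j" if "i \<le> j" for i j using a_mono[OF that] by (auto simp: A_def)
  \<comment> \<open>These at most \<nu> + 1 indices are charged the height T. For all others
    \<open>i\<close> and \<open>i + \<nu>\<close> are unaffected by clipping, and the class
    condition bounds the height.\<close>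
  define S where "S = {i. i < m \<and> (i = 0 \<or> m \<le> i + \<nu>)}"
  have "min (b i) T \<le> (A (i + \<nu>) - A i) / (c * real \<nu>) + (if i \<in> S then T else 0)" if "i < m" for i
  proof (cases "i \<in> S")
    case True
    have "0 \<le> (A (i + \<nu>) - A i) / (c * real \<nu>)"
      using A_mono[of i "i + \<nu>"] assms(1,2) by simp
    thus ?thesis using True by simp
  next
    case False
    hence "0 < i" "i + \<nu> < m" using that by (auto simp: S_def)
    hence "A (i + \<nu>) = a (i + \<nu>)" "A i = a i"
      using nonneg[of i] nonneg[of "i + \<nu>"] le[of i] le[of "i + \<nu>"] by (auto simp: A_def)
    moreover have "b i \<le> (a (i + \<nu>) - a i) / (c * real \<nu>)"
      using b[of i] assms(1,2) by (simp add: field_simps)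
    ultimately show ?thesis using False by simp
  qed
  hence "(\<Sum>i<m. min (b i) T) \<le> (\<Sum>i<m. (A (i + \<nu>) - A i) / (c * real \<nu>) + (if i \<in> S then T else 0))"
    by (intro sum_mono) auto
  also have "\<dots> = (\<Sum>i<m. A (i + \<nu>) - A i) / (c * real \<nu>) + (\<Sum>i<m. if i \<in> S then T else 0)"
    by (simp add: sum.distrib sum_divide_distrib)
  also have "(\<Sum>i<m. A (i + \<nu>) - A i) / (c * real \<nu>) \<le> real \<nu> * X / (c * real \<nu>)"
    using assms(1) A by (intro divide_right_mono sum_shift_le) auto
  also have "real \<nu> * X / (c * real \<nu>) = X / c" using \<open>0 < \<nu>\<close> by simp
  also have "(\<Sum>i<m. if i \<in> S then T else 0) = (\<Sum>i\<in>S. T)"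
    by (intro sum.mono_neutral_cong_right) (auto simp: S_def)
  also have "(\<Sum>i\<in>S. T) \<le> (real \<nu> + 1) * T"
  proof -
    have "S \<subseteq> insert 0 {m - \<nu>..<m}" by (auto simp: S_def)
    hence "card S \<le> card (insert 0 {m - \<nu>..<m})" by (intro card_mono) auto
    also have "\<dots> \<le> \<nu> + 1" using card_insert_le_m1[of "\<nu> + 1" "{m - \<nu>..<m}" 0] by simp
    finally have "real (card S) \<le> real \<nu> + 1" by linarith
    thus ?thesis using \<open>0 \<le> T\<close> by (simp add: mult_right_mono)
  qed
  finally have "(\<Sum>i<m. min (b i) T) \<le> X / c + (real \<nu> + 1) * T" by simp
  moreover have "(\<Sum>i<m. A (Suc i) - A i) \<le> X"
    using A(1)[of 0] A(2)[of m] by (simp add: sum_lessThan_telescope)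
  moreover have "(\<Sum>i<m. 2 * (A (Suc i) - A i) + 2 * min (b i) T)
      = 2 * (\<Sum>i<m. A (Suc i) - A i) + 2 * (\<Sum>i<m. min (b i) T)"
    by (simp add: sum.distrib sum_distrib_left)
  moreover have "2 * (real \<nu> + 1) * T = 2 * ((real \<nu> + 1) * T)" by simp
  ultimately show ?thesis by linarith
qed

text \<open>Per unit of X: 2 from the widths, 2 / c from the telescoping heights, and 2 tan \<alpha>
  for each of the \<nu> + 1 boxes bounded by the sector.\<close>

definition half_plane_constant :: "real \<Rightarrow> nat \<Rightarrow> real \<Rightarrow> real" where
  "half_plane_constant \<alpha> \<nu> c = 2 + 2 / c + 2 * (real \<nu> + 1) * tan \<alpha>"

text \<open>The part of the n-th curve with Re z < X lies in its box clipped to abscissae in [0, X]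
  and to the height the sector allows there, so its length is at most that perimeter; the perimeters
  are then summed.\<close>

lemma compound_arclength_half_plane:
  assumes \<gamma>: "\<gamma> \<in> boxed_class_sector \<alpha> \<nu> c" and "0 < \<alpha>" "\<alpha> < pi / 2" "0 < \<nu>" "0 < c"
  shows "AE z in compound_arclength_measure \<gamma>. 0 \<le> Re z"
    and "0 < X \<Longrightarrow> emeasure (compound_arclength_measure \<gamma>) {z. Re z < X} \<le> ennreal (half_plane_constant \<alpha> \<nu> c * X)"
proof -
  obtain a b where ab: "boxed_curve a b \<gamma>" "\<And>n. 1 \<le> n \<Longrightarrow> c * b n \<le> (a (n + \<nu>) - a n) / real \<nu>"
    using \<gamma> unfolding boxed_class_sector_def boxed_class_def by auto
  \<comment> \<open>Indices are shifted to start at 0, in accordance with the series that defines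
    the compound measure.\<close>
  define a' b' \<Gamma> where "a' n = a (Suc n)" and "b' n = b (Suc n)" and "\<Gamma> n = \<gamma> (Suc n)" for n
  have mono: "a' n < a' (Suc n)" and rect: "rectifiable (\<Gamma> n)" and conv: "convex_curve (\<Gamma> n)"
    and box: "curve_trace (\<Gamma> n) \<subseteq> cbox (complex_of_real (a' n)) (Complex (a' (Suc n)) (b' n))" for n
    using ab(1) by (auto simp: boxed_curve_def a'_def b'_def \<Gamma>_def)
  have height: "c * b' n \<le> (a' (n + \<nu>) - a' n) / real \<nu>" for n
    using ab(2)[of "Suc n"] by (simp add: a'_def b'_def)
  have sec: "0 \<le> Re z" "0 \<le> Im z" "Im z \<le> Re z * tan \<alpha>" if "z \<in> curve_trace (\<Gamma> n)" for z n
  proof -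
    have "0 \<le> Arg z" "Arg z \<le> \<alpha>"
      using \<gamma> that unfolding boxed_class_sector_def \<Gamma>_def by fastforce+
    thus "0 \<le> Re z" "0 \<le> Im z" "Im z \<le> Re z * tan \<alpha>" using sector_bounds \<open>\<alpha> < pi / 2\<close> by auto
  qed
  have inbox: "a' n \<le> Re z" "Re z \<le> a' (Suc n)" "Im z \<le> b' n" if "z \<in> curve_trace (\<Gamma> n)" for z n
    using box[of n] that by (auto simp: in_cbox_complex_iff)
  have halfplane[simp]: "{z. Re z < x} \<in> sets borel" for x by (intro borel_open open_halfspace_Re_lt)
  have null: "emeasure (arclength_measure (\<Gamma> n)) {z. Re z < x} = 0"
    if "\<And>z. z \<in> curve_trace (\<Gamma> n) \<Longrightarrow> x \<le> Re z" for n x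
  proof -
    have "fst (\<Gamma> n) \<inter> snd (\<Gamma> n) -` {z. Re z < x} = {}"
      using that by (fastforce simp: curve_trace_def)
    thus ?thesis by (simp add: emeasure_arclength_measure[OF rect])
  qed
  have "emeasure (compound_arclength_measure \<gamma>) {z. Re z < 0} = 0"
    unfolding emeasure_compound_arclength_measure[OF halfplane] \<Gamma>_def[symmetric]
    using null sec by simp
  thus "AE z in compound_arclength_measure \<gamma>. 0 \<le> Re z"
    by (intro AE_I[where N = "{z. Re z < 0}"]) (auto simp: sets_compound_arclength_measure)
  assume "0 < X"
  define A where "A i = max 0 (min X (a' i))" for i
  \<comment> \<open>No point of the sector with Re z < X is higher than this.\<close>
  define T where "T = X * tan \<alpha>"
  have "0 < tan \<alpha>" using assms by (intro tan_gt_zero) auto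
  have "0 \<le> T" using \<open>0 < X\<close> \<open>0 < tan \<alpha>\<close> by (simp add: T_def)
  \<comment> \<open>The preceding box contains a point of the sector, and a' i is the right end of
    that box. The first left edge has no such predecessor.\<close>
  have nonneg: "0 \<le> a' i" if "0 < i" for i
  proof -
    obtain n where n: "i = Suc n" using \<open>0 < i\<close> gr0_implies_Suc by blast
    have "fst (\<Gamma> n) \<noteq> {}" using rect[of n] by (auto simp: rectifiable_def is_curve_def)
    then obtain z where "z \<in> curve_trace (\<Gamma> n)" by (auto simp: curve_trace_def)
    thus ?thesis using sec[of z n] inbox[of z n] n by simp
  qed
  have one: "emeasure (arclength_measure (\<Gamma> n)) {z. Re z < X} \<le> ennreal (2 * (A (Suc n) - A n) + 2 * (min (b' n) T - 0))"
    for n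
  proof -
    let ?S = "fst (\<Gamma> n) \<inter> snd (\<Gamma> n) -` {z. Re z < X}"
    have "b' n \<ge> 0" using ab(1) by (auto simp: boxed_curve_def b'_def less_imp_le)
    have "emeasure (arclength_measure (\<Gamma> n)) {z. Re z < X} \<le> curve_length (snd (\<Gamma> n)) ?S"
      by (rule emeasure_arclength_open_le[OF rect open_halfspace_Re_lt])
    also have "\<dots> \<le> ennreal (2 * (A (Suc n) - A n) + 2 * (min (b' n) T - 0))"
    proof (rule convex_curve_length_box_le[OF conv])
      show "snd (\<Gamma> n) ` ?S \<subseteq> cbox (Complex (A n) 0) (Complex (A (Suc n)) (min (b' n) T))"
      proof clarsimp
        fix t assume t: "t \<in> fst (\<Gamma> n)" "Re (snd (\<Gamma> n) t) < X"
        let ?z = "snd (\<Gamma> n) t"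
        have z: "?z \<in> curve_trace (\<Gamma> n)" using t by (auto simp: curve_trace_def)
        have "Im ?z \<le> T"
          using sec(3)[OF z] t(2) \<open>0 < tan \<alpha>\<close> unfolding T_def
          by (meson less_imp_le mult_right_mono order_trans)
        thus "?z \<in> cbox (Complex (A n) 0) (Complex (A (Suc n)) (min (b' n) T))"
          using sec[OF z] inbox[OF z] t(2) by (auto simp: in_cbox_complex_iff A_def)
      qed
    qed (use mono[of n] \<open>b' n \<ge> 0\<close> \<open>0 \<le> T\<close> in \<open>auto simp: A_def\<close>)
    finally show ?thesis .
  qed
  have bound: "2 * X + 2 * (X / c) + 2 * (real \<nu> + 1) * T = half_plane_constant \<alpha> \<nu> c * X"
    by (simp add: half_plane_constant_def T_def algebra_simps)
  have partial: "(\<Sum>n<N. emeasure (arclength_measure (\<Gamma> n)) {z. Re z < X}) \<le> ennreal (half_plane_constant \<alpha> \<nu> c * X)" for N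
  proof (induction N)
    case (Suc N)
    show ?case
    \<comment> \<open>If box N starts left of X, so do all earlier ones and the perimeter sum
      handles them together. Otherwise the N-th term is 0 and the induction hypothesis
      applies.\<close>
    proof (cases "a' N < X")
      case True
      have "a' i \<le> a' j" if "i \<le> j" for i j
        using that mono less_imp_le by (metis lift_Suc_mono_le)
      hence le: "a' i < X" if "i < Suc N" for i using True that by (meson le_less_trans less_Suc_eq_le)
      have pos: "0 \<le> 2 * (A (Suc n) - A n) + 2 * (min (b' n) T - 0)" for n
        using mono[of n] \<open>0 \<le> T\<close> ab(1) by (auto simp: A_def b'_def boxed_curve_def less_imp_le)
      have "(\<Sum>n<Suc N. emeasure (arclength_measure (\<Gamma> n)) {z. Re z < X})
          \<le> (\<Sum>n<Suc N. ennreal (2 * (A (Suc n) - A n) + 2 * (min (b' n) T - 0)))"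
        by (intro sum_mono one)
      also have "\<dots> = ennreal (\<Sum>n<Suc N. 2 * (A (Suc n) - A n) + 2 * (min (b' n) T - 0))"
        using pos by (intro sum_ennreal) auto
      also have "\<dots> \<le> ennreal (half_plane_constant \<alpha> \<nu> c * X)"
        unfolding bound[symmetric] A_def diff_zero
        using height mono nonneg le \<open>0 < c\<close> \<open>0 < \<nu>\<close> \<open>0 \<le> T\<close> \<open>0 < X\<close>
        by (intro ennreal_leI sum_box_perimeters_le) (auto simp: less_imp_le)
      finally show ?thesis .
    next
      case False
      hence "emeasure (arclength_measure (\<Gamma> N)) {z. Re z < X} = 0"
        using inbox by (intro null) (meson linorder_not_le order_trans)
      thus ?thesis using Suc by simp
    qed
  qed simp
  have "emeasure (compound_arclength_measure \<gamma>) {z. Re z < X} = (\<Sum>n. emeasure (arclength_measure (\<Gamma> n)) {z. Re z < X})"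
    unfolding emeasure_compound_arclength_measure[OF halfplane] \<Gamma>_def ..
  also have "\<dots> \<le> ennreal (half_plane_constant \<alpha> \<nu> c * X)"
    by (rule suminf_le_const[OF summableI partial])
  finally show "emeasure (compound_arclength_measure \<gamma>) {z. Re z < X} \<le> ennreal (half_plane_constant \<alpha> \<nu> c * X)" .
qed

section \<open>The Laplace transform on boxed curves\<close>

lemma norm_laplace_kernel: "norm (f t * exp (- z * of_real t)) = norm (f t :: complex) * exp (- t * Re z)"
  by (simp add: norm_mult norm_exp_eq_Re mult.commute)

lemma real_laplace_norm:
  "real_laplace (\<lambda>t. norm (f t)) z = (\<integral>\<^sup>+t. ennreal (norm (f t * exp (- z * of_real t) :: complex)) \<partial>lborel_pos)"
  unfolding real_laplace_def norm_laplace_kernel ..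

lemma borel_measurable_lborel_pos_id: "(\<lambda>t. t) \<in> borel_measurable lborel_pos"
  by (simp add: measurable_restrict_space1)

lemma laplace_integrable_iff:
  assumes [measurable]: "f \<in> borel_measurable lborel_pos"
  shows "laplace_integrable f z \<longleftrightarrow> real_laplace (\<lambda>t. norm (f t)) z < \<infinity>"
proof -
  note borel_measurable_lborel_pos_id[measurable]
  have "(\<lambda>t. f t * exp (- z * of_real t)) \<in> borel_measurable lborel_pos" by measurable
  thus ?thesis unfolding laplace_integrable_def integrable_iff_bounded real_laplace_norm by simp
qed

lemma norm_laplace_le:
  assumes "laplace_integrable f z"
  shows "ennreal (norm (laplace f z)) \<le> real_laplace (\<lambda>t. norm (f t)) z"
  using assms unfolding laplace_integrable_def laplace_def real_laplace_norm
  by (rule integral_norm_bound_ennreal)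

lemma borel_measurable_laplace:
  assumes [measurable]: "f \<in> borel_measurable lborel_pos"
  shows "laplace f \<in> borel_measurable borel"
proof -
  interpret N: sigma_finite_measure lborel_pos by (rule sigma_finite_lborel_pos)
  have [measurable]: "snd \<in> borel_measurable (borel \<Otimes>\<^sub>M lborel_pos)"
    by (rule measurable_compose[OF measurable_snd borel_measurable_lborel_pos_id])
  have "(\<lambda>z. LINT t|lborel_pos. f t * exp (- z * of_real t)) \<in> borel_measurable borel"
    by (rule N.borel_measurable_lebesgue_integral) measurable
  thus ?thesis unfolding laplace_def[abs_def] .
qed

lemma laplace_diff:
  assumes "laplace_integrable f z" "laplace_integrable g z"
  shows "laplace g z - laplace f z = laplace (\<lambda>t. g t - f t) z"
  using assms unfolding laplace_integrable_def laplace_def by (simp add: left_diff_distrib)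

lemma Lp_norm_cong_AE:
  assumes "u \<in> borel_measurable M" "v \<in> borel_measurable M" "AE x in M. u x = v x"
  shows "Lp_norm q M u = Lp_norm q M v"
proof -
  have "esssup M (\<lambda>x. ennreal (norm (u x))) = esssup M (\<lambda>x. ennreal (norm (v x)))"
    using assms by (intro esssup_AE_cong) auto
  moreover have "(\<integral>\<^sup>+x. ennreal (norm (u x) powr enn2real q) \<partial>M) = (\<integral>\<^sup>+x. ennreal (norm (v x) powr enn2real q) \<partial>M)"
    using assms(3) by (intro nn_integral_cong_AE) auto
  ultimately show ?thesis by (simp add: Lp_norm_def)
qed

lemma laplace_bounded_1:
  fixes M :: "complex measure"
  assumes sets: "sets M = sets borel" and pos: "AE z in M. 0 \<le> Re z" and f: "f \<in> Lp_space 1 lborel_pos"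
  shows "AE z in M. laplace_integrable f z" "Lp_norm \<infinity> M (laplace f) \<le> Lp_norm 1 lborel_pos f"
proof -
  have meas: "f \<in> borel_measurable lborel_pos" and fin: "Lp_norm 1 lborel_pos f < \<infinity>"
    using f by (auto simp: Lp_space_def)
  define J where "J = (\<integral>\<^sup>+t. ennreal (norm (f t)) \<partial>lborel_pos)"
  have J: "J < \<infinity>" "Lp_norm 1 lborel_pos f = J"
    using fin by (auto simp: Lp_norm_def J_def Let_def less_top split: if_splits)
  have le: "real_laplace (\<lambda>t. norm (f t)) z \<le> J" if "0 \<le> Re z" for z
    unfolding real_laplace_def J_def using that
    by (intro nn_integral_mono ennreal_leI) (auto simp: space_restrict_space intro!: mult_left_le)
  have int: "laplace_integrable f z" if "0 \<le> Re z" for z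
    using le[OF that] J(1) by (simp add: laplace_integrable_iff[OF meas])
  show "AE z in M. laplace_integrable f z" using pos by eventually_elim (rule int)
  have "AE z in M. ennreal (norm (laplace f z)) \<le> J"
    using pos by eventually_elim (meson int le norm_laplace_le order_trans)
  moreover have "laplace f \<in> borel_measurable M"
    using borel_measurable_laplace[OF meas] by (simp add: measurable_cong_sets[OF sets refl])
  ultimately show "Lp_norm \<infinity> M (laplace f) \<le> Lp_norm 1 lborel_pos f"
    unfolding J(2) by (simp add: Lp_norm_def esssup_I)
qed

lemma laplace_bounded_interpolated:
  fixes M :: "complex measure" and p q :: real
  assumes sets: "sets M = sets borel" and pos: "AE z in M. 0 \<le> Re z"
    and bound: "\<And>X. 0 < X \<Longrightarrow> emeasure M {z. Re z < X} \<le> ennreal (D * X)" and "0 \<le> D"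
    and p: "1 < p" "p \<le> 2" "1 / p + 1 / q = 1" "0 < q"
    and f: "f \<in> Lp_space (ennreal p) lborel_pos"
  shows "AE z in M. laplace_integrable f z"
    and "Lp_norm (ennreal q) M (laplace f) \<le> ennreal ((pi * D) powr (1 / q)) * Lp_norm (ennreal p) lborel_pos f"
proof -
  have meas[measurable]: "f \<in> borel_measurable lborel_pos" and fin: "Lp_norm (ennreal p) lborel_pos f < \<infinity>"
    using f by (auto simp: Lp_space_def)
  define J where "J = enn2real (\<integral>\<^sup>+t. ennreal (norm (f t) powr p) \<partial>lborel_pos)"
  have J: "(\<integral>\<^sup>+t. ennreal (norm (f t) powr p) \<partial>lborel_pos) = ennreal J" "0 \<le> J"
    "Lp_norm (ennreal p) lborel_pos f = ennreal (J powr (1 / p))"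
    using fin p by (auto simp: Lp_norm_def J_def Let_def less_top split: if_splits)
  let ?g = "\<lambda>t. norm (f t)"
  have fin': "AE z in M. real_laplace ?g z < \<infinity>"
    and le: "(\<integral>\<^sup>+z. ennreal (enn2real (real_laplace ?g z) powr q) \<partial>M) \<le> ennreal (pi * D * J powr (q - 1))"
    using real_laplace_interpolation[OF sets pos bound \<open>0 \<le> D\<close> p(1-3) _ _ J(1,2)] by auto
  show int: "AE z in M. laplace_integrable f z"
    using fin' by eventually_elim (simp add: laplace_integrable_iff[OF meas])
  define L where "L = (\<integral>\<^sup>+z. ennreal (norm (laplace f z) powr q) \<partial>M)"
  have "L \<le> (\<integral>\<^sup>+z. ennreal (enn2real (real_laplace ?g z) powr q) \<partial>M)"
    unfolding L_def
  proof (intro nn_integral_mono_AE, use int fin' in eventually_elim)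
    case (elim z)
    hence "norm (laplace f z) \<le> enn2real (real_laplace ?g z)"
      using enn2real_mono[OF norm_laplace_le[OF elim(1)]] by simp
    thus ?case using p(4) by (intro ennreal_leI powr_mono2) auto
  qed
  hence L: "L \<le> ennreal (pi * D * J powr (q - 1))" using le by (rule order_trans)
  hence "L \<noteq> \<infinity>" by (auto simp: top_unique)
  have "enn2real L \<le> pi * D * J powr (q - 1)"
    using L \<open>0 \<le> D\<close> by (intro enn2real_leI) auto
  hence "enn2real L powr (1 / q) \<le> (pi * D * J powr (q - 1)) powr (1 / q)"
    using p(4) by (intro powr_mono2) auto
  also have "\<dots> = (pi * D) powr (1 / q) * J powr ((q - 1) * (1 / q))"
    using \<open>0 \<le> D\<close> by (simp add: powr_mult powr_powr)
  \<comment> \<open>Taking the q-th root turns J^(q - 1) into J^(1/p), which is the norm of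
    f.\<close>
  also have "(q - 1) * (1 / q) = 1 - 1 / q" using p(4) by (simp add: diff_divide_distrib)
  also have "\<dots> = 1 / p" using p(3) by linarith
  finally have "ennreal (enn2real L powr (1 / q)) \<le> ennreal ((pi * D) powr (1 / q)) * ennreal (J powr (1 / p))"
    by (simp add: ennreal_mult[symmetric] ennreal_leI)
  thus "Lp_norm (ennreal q) M (laplace f) \<le> ennreal ((pi * D) powr (1 / q)) * Lp_norm (ennreal p) lborel_pos f"
    unfolding J(3) using \<open>L \<noteq> \<infinity>\<close> p(4) by (simp add: Lp_norm_def L_def[symmetric] Let_def)
qed

text \<open>Passes from extended exponents to real ones: p' infinite forces p = 1, and otherwise
  both exponents are finite and positive.\<close>

lemma conjugate_exponent_cases:
  fixes p p' :: ennreal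
  assumes "1 \<le> p" "p \<le> 2" "inverse p + inverse p' = 1"
  obtains "p = 1" "p' = \<infinity>"
  | r q where "p = ennreal r" "p' = ennreal q" "1 < r" "r \<le> 2" "1 / r + 1 / q = 1" "0 < q"
proof -
  have "p < \<infinity>" using assms(2) by (auto intro: le_less_trans)
  then obtain r where r: "p = ennreal r" "0 \<le> r" by (cases p) auto
  hence "1 \<le> r" "r \<le> 2" using assms(1,2) by (simp_all add: ennreal_le_iff2 flip: ennreal_1 ennreal_numeral)
  have inv: "inverse p = ennreal (1 / r)" using r \<open>1 \<le> r\<close> by (simp add: inverse_ennreal inverse_eq_divide)
  show thesis
  proof (cases p')
    case top
    hence "ennreal (1 / r) = ennreal 1" using assms(3) inv by simp
    hence "r = 1" using \<open>1 \<le> r\<close> by (subst (asm) ennreal_inj) auto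
    thus ?thesis using that(1) r top by simp
  next
    case (real q)
    have "0 < q"
    proof (rule ccontr)
      assume "\<not> 0 < q"
      \<comment> \<open>This is impossible because the inverse of 0 is infinity in
        \<open>ennreal\<close>.\<close>
      hence "p' = 0" using real by simp
      thus False using assms(3) by simp
    qed
    hence "inverse p' = ennreal (1 / q)" using real by (simp add: inverse_ennreal inverse_eq_divide)
    hence "ennreal (1 / r + 1 / q) = ennreal 1" using assms(3) inv \<open>1 \<le> r\<close> \<open>0 < q\<close> by simp
    hence eq: "1 / r + 1 / q = 1" using \<open>1 \<le> r\<close> \<open>0 < q\<close> by (subst (asm) ennreal_inj) auto
    hence "r \<noteq> 1" using \<open>0 < q\<close> by auto
    thus ?thesis using that(2) r real \<open>1 \<le> r\<close> \<open>r \<le> 2\<close> \<open>0 < q\<close> eq by simp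
  qed
qed

lemma laplace_bounded:
  fixes M :: "complex measure" and p p' :: ennreal
  assumes sets: "sets M = sets borel" and pos: "AE z in M. 0 \<le> Re z"
    and bound: "\<And>X. 0 < X \<Longrightarrow> emeasure M {z. Re z < X} \<le> ennreal (D * X)" and "0 < D"
    and p: "1 \<le> p" "p \<le> 2" "inverse p + inverse p' = 1"
    and f: "f \<in> Lp_space p lborel_pos"
  shows "AE z in M. laplace_integrable f z"
    and "Lp_norm p' M (laplace f) \<le> ennreal ((pi * D) powr enn2real (inverse p')) * Lp_norm p lborel_pos f"
proof -
  have "(AE z in M. laplace_integrable f z) \<and>
    Lp_norm p' M (laplace f) \<le> ennreal ((pi * D) powr enn2real (inverse p')) * Lp_norm p lborel_pos f"
    using p
  proof (cases rule: conjugate_exponent_cases)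
    case 1
    \<comment> \<open>The exponent is 0, and \<open>(pi * D) powr 0\<close> is 1 because D is
      positive; it would be 0 for D = 0.\<close>
    thus ?thesis using laplace_bounded_1[OF sets pos] f \<open>0 < D\<close> by simp
  next
    case (2 r q)
    have "enn2real (inverse p') = 1 / q" using 2 by (simp add: inverse_ennreal inverse_eq_divide)
    thus ?thesis
      using laplace_bounded_interpolated[OF sets pos bound less_imp_le[OF \<open>0 < D\<close>] 2(3-6)] f 2(1,2) by simp
  qed
  thus "AE z in M. laplace_integrable f z"
    "Lp_norm p' M (laplace f) \<le> ennreal ((pi * D) powr enn2real (inverse p')) * Lp_norm p lborel_pos f"
    by auto
qed

text \<open>A bounded linear operator is continuous, but \<open>laplace\<close> is additive only
  where both integrals converge, since a divergent one has the value 0. Convergence almost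
  everywhere makes the difference formula hold up to a null set.\<close>

lemma laplace_acts_continuously:
  fixes M :: "complex measure"
  assumes sets: "sets M = sets borel" and "0 < C"
    and int: "\<And>f. f \<in> Lp_space p lborel_pos \<Longrightarrow> AE z in M. laplace_integrable f z"
    and le: "\<And>f. f \<in> Lp_space p lborel_pos \<Longrightarrow> Lp_norm q M (laplace f) \<le> ennreal C * Lp_norm p lborel_pos f"
  shows "acts_continuously p lborel_pos q M laplace"
proof -
  have meas: "laplace f \<in> borel_measurable M" if "f \<in> borel_measurable lborel_pos" for f
    using borel_measurable_laplace[OF that] by (simp add: measurable_cong_sets[OF sets refl])
  have measf: "f \<in> borel_measurable lborel_pos" if "f \<in> Lp_space p lborel_pos" for f
    using that by (simp add: Lp_space_def)
  have "laplace f \<in> Lp_space q M" if f: "f \<in> Lp_space p lborel_pos" for f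
  proof -
    have "ennreal C * Lp_norm p lborel_pos f < \<infinity>"
      using f by (simp add: Lp_space_def ennreal_mult_less_top)
    thus ?thesis using le[OF f] meas[OF measf[OF f]] by (auto simp: Lp_space_def intro: le_less_trans)
  qed
  moreover have "\<exists>\<delta>>0. \<forall>g\<in>Lp_space p lborel_pos.
      Lp_norm p lborel_pos (\<lambda>x. g x - f x) < \<delta> \<longrightarrow> Lp_norm q M (\<lambda>y. laplace g y - laplace f y) < \<epsilon>"
    if f: "f \<in> Lp_space p lborel_pos" and "0 < \<epsilon>" for f and \<epsilon> :: ennreal
  proof (intro exI[of _ "\<epsilon> / ennreal C"] conjI ballI impI)
    show "0 < \<epsilon> / ennreal C"
      using \<open>0 < \<epsilon>\<close> by (simp add: zero_less_iff_neq_zero ennreal_divide_eq_0_iff)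
    fix g assume g: "g \<in> Lp_space p lborel_pos" and lt: "Lp_norm p lborel_pos (\<lambda>x. g x - f x) < \<epsilon> / ennreal C"
    have "(\<lambda>x. g x - f x) \<in> borel_measurable lborel_pos" using measf f g by auto
    \<comment> \<open>The closeness assumption itself gives finiteness, so Minkowski's inequality
      does not enter.\<close>
    moreover have "Lp_norm p lborel_pos (\<lambda>x. g x - f x) < \<infinity>" using lt by (auto intro: less_le_trans)
    ultimately have d: "(\<lambda>x. g x - f x) \<in> Lp_space p lborel_pos" by (simp add: Lp_space_def)
    have "AE y in M. laplace g y - laplace f y = laplace (\<lambda>x. g x - f x) y"
      using int[OF f] int[OF g] by eventually_elim (rule laplace_diff)
    hence "Lp_norm q M (\<lambda>y. laplace g y - laplace f y) = Lp_norm q M (laplace (\<lambda>x. g x - f x))"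
      using meas measf f g d by (intro Lp_norm_cong_AE) auto
    also have "\<dots> \<le> ennreal C * Lp_norm p lborel_pos (\<lambda>x. g x - f x)" by (rule le[OF d])
    also have "\<dots> < ennreal C * (\<epsilon> / ennreal C)"
      using lt \<open>0 < C\<close> by (intro ennreal_mult_strict_left_mono) auto
    also have "\<dots> = \<epsilon>"
      using \<open>0 < C\<close> by (simp add: ennreal_times_divide mult.commute[of "ennreal C"] ennreal_mult_divide_eq)
    finally show "Lp_norm q M (\<lambda>y. laplace g y - laplace f y) < \<epsilon>" .
  qed
  ultimately show ?thesis unfolding acts_continuously_def by blast
qed

lemma boxed_laplace_bounded:
  fixes p p' :: ennreal and \<alpha> c :: real and \<nu> :: nat
  assumes p: "1 \<le> p" "p \<le> 2" "inverse p + inverse p' = 1"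
    and "0 < \<alpha>" "\<alpha> < pi / 2" "\<nu> \<ge> 1" "c > 0" and \<gamma>: "\<gamma> \<in> boxed_class_sector \<alpha> \<nu> c"
  defines "C \<equiv> (pi * half_plane_constant \<alpha> \<nu> c) powr enn2real (inverse p')"
  shows "\<forall>f\<in>Lp_space p lborel_pos. AE z in compound_arclength_measure \<gamma>. laplace_integrable f z"
    and "acts_continuously p lborel_pos p' (compound_arclength_measure \<gamma>) laplace"
    and "Lp_op_norm p lborel_pos p' (compound_arclength_measure \<gamma>) laplace \<le> ennreal C"
proof -
  let ?M = "compound_arclength_measure \<gamma>"
  have "0 < tan \<alpha>" using assms by (intro tan_gt_zero) auto
  hence D: "0 < half_plane_constant \<alpha> \<nu> c"
    using \<open>c > 0\<close> unfolding half_plane_constant_def by (intro add_pos_nonneg) auto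
  have "0 < \<nu>" using \<open>\<nu> \<ge> 1\<close> by simp
  note half = compound_arclength_half_plane[OF \<gamma> assms(4,5) \<open>0 < \<nu>\<close> \<open>c > 0\<close>]
  have bd: "AE z in ?M. laplace_integrable f z" "Lp_norm p' ?M (laplace f) \<le> ennreal C * Lp_norm p lborel_pos f"
    if "f \<in> Lp_space p lborel_pos" for f
    unfolding C_def
    by (rule laplace_bounded[OF sets_compound_arclength_measure half(1) half(2) D p that], assumption)+
  have "0 < C" using D by (simp add: C_def)
  show "\<forall>f\<in>Lp_space p lborel_pos. AE z in ?M. laplace_integrable f z" using bd(1) by blast
  show "acts_continuously p lborel_pos p' ?M laplace"
    by (rule laplace_acts_continuously[OF sets_compound_arclength_measure \<open>0 < C\<close> bd])
  show "Lp_op_norm p lborel_pos p' ?M laplace \<le> ennreal C"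
    unfolding Lp_op_norm_def
  proof (rule SUP_least, safe)
    fix f assume f: "f \<in> Lp_space p lborel_pos" "Lp_norm p lborel_pos f \<le> 1"
    have "Lp_norm p' ?M (laplace f) \<le> ennreal C * Lp_norm p lborel_pos f" by (rule bd(2)[OF f(1)])
    also have "\<dots> \<le> ennreal C * 1" using f(2) by (rule mult_left_mono) simp
    finally show "Lp_norm p' ?M (laplace f) \<le> ennreal C" by simp
  qed
qed

text \<open>For p = 1 the exponent of the last bound is 0 and the bound equals 1. Normalised
  indicators of (0, e) with e tending to 0 show that the norm is 1 as well, so the inequality cannot
  be strict there. For p > 1 strictness survives the supremum because every norm is bounded by one
  and the same smaller constant.\<close>

theorem theorem9:
  fixes p p' :: ennreal and \<alpha> c :: real and \<nu> :: nat
  assumes "1 \<le> p" and "p \<le> 2" and "inverse p + inverse p' = 1"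
    and "0 < \<alpha>" and "\<alpha> < pi / 2" and "\<nu> \<ge> 1" and "c > 0"
  shows "(\<exists>C::real. \<forall>\<gamma>\<in>boxed_class_sector \<alpha> \<nu> c.
            (\<forall>f\<in>Lp_space p lborel_pos.
               AE z in compound_arclength_measure \<gamma>. laplace_integrable f z) \<and>
            acts_continuously p lborel_pos p' (compound_arclength_measure \<gamma>) laplace \<and>
            Lp_op_norm p lborel_pos p' (compound_arclength_measure \<gamma>) laplace \<le> ennreal C)
       \<and> (p \<noteq> 1 \<longrightarrow>
            (SUP \<gamma>\<in>boxed_class_sector (pi / 4) 1 c.
               Lp_op_norm p lborel_pos p' (compound_arclength_measure \<gamma>) laplace)
            < ennreal ((1344 * pi * (1 / c + 2)) powr enn2real (inverse p')))
       \<and> (p = 1 \<longrightarrow>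
            (SUP \<gamma>\<in>boxed_class_sector (pi / 4) 1 c.
               Lp_op_norm p lborel_pos p' (compound_arclength_measure \<gamma>) laplace)
            \<le> ennreal ((1344 * pi * (1 / c + 2)) powr enn2real (inverse p')))"
proof -
  let ?S = "SUP \<gamma>\<in>boxed_class_sector (pi / 4) 1 c.
    Lp_op_norm p lborel_pos p' (compound_arclength_measure \<gamma>) laplace"
  let ?e = "enn2real (inverse p')"
  have sup: "?S \<le> ennreal ((pi * (6 + 2 / c)) powr ?e)"
  proof (rule SUP_least)
    fix \<gamma> assume \<gamma>: "\<gamma> \<in> boxed_class_sector (pi / 4) 1 c"
    have "Lp_op_norm p lborel_pos p' (compound_arclength_measure \<gamma>) laplace
        \<le> ennreal ((pi * half_plane_constant (pi / 4) 1 c) powr ?e)"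
      by (rule boxed_laplace_bounded(3)[OF assms(1-3) _ _ _ \<open>c > 0\<close> \<gamma>]) simp_all
    also have "half_plane_constant (pi / 4) 1 c = 6 + 2 / c" by (simp add: half_plane_constant_def tan_45)
    finally show "Lp_op_norm p lborel_pos p' (compound_arclength_measure \<gamma>) laplace
        \<le> ennreal ((pi * (6 + 2 / c)) powr ?e)" .
  qed
  \<comment> \<open>The number 6 is 2 + 2 (1 + 1) tan (pi/4), from
    \<open>half_plane_constant\<close> with \<nu> = 1.\<close>
  have "6 + 2 * x < 1344 * (x + 2)" if "0 < x" for x :: real using that by simp
  from this[of "1 / c"] have "6 + 2 / c < 1344 * (1 / c + 2)" using \<open>c > 0\<close> by simp
  hence lt: "pi * (6 + 2 / c) < 1344 * pi * (1 / c + 2)"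
    using mult_strict_left_mono[OF _ pi_gt_zero] by (simp only: mult.assoc mult.left_commute[of 1344 pi])
  have pos: "0 \<le> pi * (6 + 2 / c)" using \<open>c > 0\<close> by simp
  have strict: "?S < ennreal ((1344 * pi * (1 / c + 2)) powr ?e)" if "p \<noteq> 1"
    using assms(1-3)
  proof (cases rule: conjugate_exponent_cases)
    case 1
    thus ?thesis using that by simp
  next
    case (2 r q)
    hence "0 < ?e" by (simp add: inverse_ennreal)
    hence "(pi * (6 + 2 / c)) powr ?e < (1344 * pi * (1 / c + 2)) powr ?e"
      using pos lt by (intro powr_less_mono2) auto
    hence "ennreal ((pi * (6 + 2 / c)) powr ?e) < ennreal ((1344 * pi * (1 / c + 2)) powr ?e)"
      by (intro ennreal_lessI) auto
    with sup show ?thesis by (rule le_less_trans)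
  qed
  have weak: "?S \<le> ennreal ((1344 * pi * (1 / c + 2)) powr ?e)"
    using sup by (rule order_trans) (intro ennreal_leI powr_mono2 pos less_imp_le[OF lt], simp)
  show ?thesis
  proof (intro conjI exI ballI)
    fix \<gamma> assume "\<gamma> \<in> boxed_class_sector \<alpha> \<nu> c"
    note bounded = boxed_laplace_bounded[OF assms this]
    show "AE z in compound_arclength_measure \<gamma>. laplace_integrable f z" if "f \<in> Lp_space p lborel_pos" for f
      using bounded(1) that by (rule bspec)
    show "acts_continuously p lborel_pos p' (compound_arclength_measure \<gamma>) laplace"
      by (rule bounded(2))
    show "Lp_op_norm p lborel_pos p' (compound_arclength_measure \<gamma>) laplace
        \<le> ennreal ((pi * half_plane_constant \<alpha> \<nu> c) powr ?e)"
      by (rule bounded(3))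
  qed (rule impI, erule strict, rule impI, rule weak)
qed

end
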